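(* Let $\mathcal{A}$ be the (strict) monoidal category freely generated by an idempotent object $(A,\alpha)$. Then the automorphism group $\mathrm{Aut}_{\mathcal{A}}(A)$ is isomorphic, as a group, to Thompson's group $F$.
   Context: All monoidal categories and monoidal functors are strict: a monoidal category is a category $\mathcal{M}$ with a functor $\otimes:\mathcal{M}\times\mathcal{M}\to\mathcal{M}$ and a unit object $I$ satisfying the associativity and unit laws as equalities, on both objects and maps. No symmetry is assumed. A monoidal functor is a functor preserving $\otimes$ and $I$ strictly (as equalities, on objects and maps). An idempotent object in a monoidal category $\mathcal{M}$ is a pair $(M,\mu)$ consisting of an object $M\in\mathcal{M}$ and an isomorphism $\mu: M\otimes M\to M$ (no equations are imposed on $\mu$). A monoidal category freely generated by an idempotent object is a monoidal category $\mathcal{A}$ together with an idempotent object $(A,\alpha)$ in $\mathcal{A}$ such that for every monoidal category $\mathcal{M}$ and every idempotent object $(M,\mu)$ in $\mathcal{M}$, there is a unique monoidal functor $G:\mathcal{A}\to\mathcal{M}$ with $G(A)=M$ and $G(\alpha)=\mu$. This universal property determines $(\mathcal{A},A,\alpha)$ uniquely up to isomorphism. For an object $X$ of a category $\mathcal{X}$, $\mathrm{Aut}_{\mathcal{X}}(X)$ is the group of isomorphisms $X\to X$ in $\mathcal{X}$ under composition. Thompson's group $F$ is the group, under composition, of all bijections $f:[0,1]\to[0,1]$ such that: (i) $f$ is (continuous and) piecewise linear with only finitely many pieces; (ii) the slope of each piece is an integer power of $2$; (iii) the coordinates of the endpoints of each piece are dyadic rationals. *)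

theory Defs
  imports Complex_Main "HOL-Algebra.Bij"
begin

section \<open>Strict monoidal categories\<close>

text \<open>
  The operations are total functions on the types \<open>'o\<close> (objects) and \<open>'m\<close> (maps); their values
  outside the carriers \<open>Ob\<close> and \<open>Ar\<close>, and the value of \<open>g \<cdot> f\<close> when \<open>Tgt f \<noteq> Src g\<close>, are junk.
  Composition is written in the order of function composition: \<open>g \<cdot> f\<close> is \<open>f\<close> followed by \<open>g\<close>.
\<close>

record ('o, 'm) moncat =
  Ob :: "'o set"
  Ar :: "'m set"
  Src :: "'m \<Rightarrow> 'o" ("Src\<index>")
  Tgt :: "'m \<Rightarrow> 'o" ("Tgt\<index>")
  Idn :: "'o \<Rightarrow> 'm" ("Idn\<index>")
  Cmp :: "'m \<Rightarrow> 'm \<Rightarrow> 'm" (infixl "\<cdot>\<index>" 70)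
  TensOb :: "'o \<Rightarrow> 'o \<Rightarrow> 'o" (infixl "\<odot>\<index>" 75)
  TensAr :: "'m \<Rightarrow> 'm \<Rightarrow> 'm" (infixl "\<boxtimes>\<index>" 75)
  UnitOb :: "'o" ("UnitOb\<index>")

definition hom_set :: "('o, 'm) moncat \<Rightarrow> 'o \<Rightarrow> 'o \<Rightarrow> 'm set" where
  "hom_set C X Y = {f \<in> Ar C. Src\<^bsub>C\<^esub> f = X \<and> Tgt\<^bsub>C\<^esub> f = Y}"

locale small_category =
  fixes C :: "('o, 'm) moncat" (structure)
  assumes Src_Ob: "f \<in> Ar C \<Longrightarrow> Src f \<in> Ob C"
    and Tgt_Ob: "f \<in> Ar C \<Longrightarrow> Tgt f \<in> Ob C"
    and Idn_hom: "X \<in> Ob C \<Longrightarrow> Idn X \<in> hom_set C X X"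
    and Cmp_hom: "\<lbrakk>f \<in> hom_set C X Y; g \<in> hom_set C Y Z\<rbrakk> \<Longrightarrow> g \<cdot> f \<in> hom_set C X Z"
    and Cmp_Idn_right: "f \<in> hom_set C X Y \<Longrightarrow> f \<cdot> Idn X = f"
    and Cmp_Idn_left: "f \<in> hom_set C X Y \<Longrightarrow> Idn Y \<cdot> f = f"
    and Cmp_assoc:
      "\<lbrakk>f \<in> hom_set C W X; g \<in> hom_set C X Y; h \<in> hom_set C Y Z\<rbrakk>
        \<Longrightarrow> (h \<cdot> g) \<cdot> f = h \<cdot> (g \<cdot> f)"

text \<open>
  The assumptions up to \<open>Tens_Cmp\<close> say that the tensor product is a functor from the product
  category \<open>C \<times> C\<close> to \<open>C\<close>.
\<close>

locale strict_monoidal_category = small_category +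
  assumes TensOb_Ob: "\<lbrakk>X \<in> Ob C; Y \<in> Ob C\<rbrakk> \<Longrightarrow> X \<odot> Y \<in> Ob C"
    and TensAr_hom:
      "\<lbrakk>f \<in> hom_set C X Y; f' \<in> hom_set C X' Y'\<rbrakk>
        \<Longrightarrow> f \<boxtimes> f' \<in> hom_set C (X \<odot> X') (Y \<odot> Y')"
    and Tens_Idn: "\<lbrakk>X \<in> Ob C; Y \<in> Ob C\<rbrakk> \<Longrightarrow> Idn X \<boxtimes> Idn Y = Idn (X \<odot> Y)"
    and Tens_Cmp:
      "\<lbrakk>f \<in> hom_set C X Y; g \<in> hom_set C Y Z; f' \<in> hom_set C X' Y'; g' \<in> hom_set C Y' Z'\<rbrakk>
        \<Longrightarrow> (g \<cdot> f) \<boxtimes> (g' \<cdot> f') = (g \<boxtimes> g') \<cdot> (f \<boxtimes> f')"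
    and UnitOb_Ob: "UnitOb \<in> Ob C"
    and TensOb_assoc:
      "\<lbrakk>X \<in> Ob C; Y \<in> Ob C; Z \<in> Ob C\<rbrakk> \<Longrightarrow> (X \<odot> Y) \<odot> Z = X \<odot> (Y \<odot> Z)"
    and TensOb_unit_left: "X \<in> Ob C \<Longrightarrow> UnitOb \<odot> X = X"
    and TensOb_unit_right: "X \<in> Ob C \<Longrightarrow> X \<odot> UnitOb = X"
    and TensAr_assoc:
      "\<lbrakk>f \<in> Ar C; g \<in> Ar C; h \<in> Ar C\<rbrakk> \<Longrightarrow> (f \<boxtimes> g) \<boxtimes> h = f \<boxtimes> (g \<boxtimes> h)"
    and TensAr_unit_left: "f \<in> Ar C \<Longrightarrow> Idn UnitOb \<boxtimes> f = f"
    and TensAr_unit_right: "f \<in> Ar C \<Longrightarrow> f \<boxtimes> Idn UnitOb = f"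

locale strict_monoidal_functor =
  C: strict_monoidal_category C + D: strict_monoidal_category D
  for C :: "('o, 'm) moncat" and D :: "('p, 'q) moncat" +
  fixes Fo :: "'o \<Rightarrow> 'p" and Fa :: "'m \<Rightarrow> 'q"
  assumes Fo_Ob: "X \<in> Ob C \<Longrightarrow> Fo X \<in> Ob D"
    and Fa_hom: "f \<in> hom_set C X Y \<Longrightarrow> Fa f \<in> hom_set D (Fo X) (Fo Y)"
    and Fa_Idn: "X \<in> Ob C \<Longrightarrow> Fa (Idn\<^bsub>C\<^esub> X) = Idn\<^bsub>D\<^esub> (Fo X)"
    and Fa_Cmp:
      "\<lbrakk>f \<in> hom_set C X Y; g \<in> hom_set C Y Z\<rbrakk> \<Longrightarrow> Fa (g \<cdot>\<^bsub>C\<^esub> f) = Fa g \<cdot>\<^bsub>D\<^esub> Fa f"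
    and Fo_Tens: "\<lbrakk>X \<in> Ob C; Y \<in> Ob C\<rbrakk> \<Longrightarrow> Fo (X \<odot>\<^bsub>C\<^esub> Y) = Fo X \<odot>\<^bsub>D\<^esub> Fo Y"
    and Fa_Tens: "\<lbrakk>f \<in> Ar C; g \<in> Ar C\<rbrakk> \<Longrightarrow> Fa (f \<boxtimes>\<^bsub>C\<^esub> g) = Fa f \<boxtimes>\<^bsub>D\<^esub> Fa g"
    and Fo_Unit: "Fo UnitOb\<^bsub>C\<^esub> = UnitOb\<^bsub>D\<^esub>"

definition iso_set :: "('o, 'm) moncat \<Rightarrow> 'o \<Rightarrow> 'o \<Rightarrow> 'm set" where
  "iso_set C X Y = {f \<in> hom_set C X Y.
     \<exists>g \<in> hom_set C Y X. g \<cdot>\<^bsub>C\<^esub> f = Idn\<^bsub>C\<^esub> X \<and> f \<cdot>\<^bsub>C\<^esub> g = Idn\<^bsub>C\<^esub> Y}"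

definition aut_group :: "('o, 'm) moncat \<Rightarrow> 'o \<Rightarrow> 'm monoid" where
  "aut_group C X = \<lparr>carrier = iso_set C X X, mult = Cmp C, one = Idn\<^bsub>C\<^esub> X\<rparr>"


section \<open>Idempotent objects and the free monoidal category on one\<close>

definition idempotent_object :: "('o, 'm) moncat \<Rightarrow> 'o \<Rightarrow> 'm \<Rightarrow> bool" where
  "idempotent_object C M \<mu> \<longleftrightarrow> M \<in> Ob C \<and> \<mu> \<in> iso_set C (M \<odot>\<^bsub>C\<^esub> M) M"

text \<open>
  HOL cannot quantify over types inside a formula, so the universal property is relative to a
  universe: it is tested against all monoidal categories with objects in \<open>'p\<close> and maps in \<open>'q\<close>.
  A free monoidal category on an idempotent object is countable.  Hence, for \<open>C\<close> over \<open>'o\<close> and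
  \<open>'m\<close>, the universe \<open>'o + nat\<close>, \<open>'m + nat\<close> contains copies both of \<open>C\<close> and of a free one, and
  the universal property relative to it implies the one for every choice of \<open>'p\<close> and \<open>'q\<close>.
  (For small universes this fails: the one-map category is free relative to \<open>unit\<close>, \<open>unit\<close>.)

  A functor is a pair of total functions, so uniqueness means agreement on \<open>Ob C\<close> and \<open>Ar C\<close>.
\<close>

definition freely_generated_by_idempotent ::
  "'p itself \<Rightarrow> 'q itself \<Rightarrow> ('o, 'm) moncat \<Rightarrow> 'o \<Rightarrow> 'm \<Rightarrow> bool" where
  "freely_generated_by_idempotent _ _ C A \<alpha> \<longleftrightarrow>
     strict_monoidal_category C \<and> idempotent_object C A \<alpha> \<and>
     (\<forall>(D :: ('p, 'q) moncat) M \<mu>.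
        strict_monoidal_category D \<and> idempotent_object D M \<mu> \<longrightarrow>
        (\<exists>Go Ga. strict_monoidal_functor C D Go Ga \<and> Go A = M \<and> Ga \<alpha> = \<mu> \<and>
          (\<forall>Ho Ha. strict_monoidal_functor C D Ho Ha \<and> Ho A = M \<and> Ha \<alpha> = \<mu> \<longrightarrow>
             (\<forall>X \<in> Ob C. Ho X = Go X) \<and> (\<forall>f \<in> Ar C. Ha f = Ga f))))"


section \<open>Thompson's group F\<close>

definition dyadic_rationals :: "real set" where
  "dyadic_rationals = {of_int m / 2 ^ k | (m :: int) (k :: nat). True}"

text \<open>
  The pieces are the graphs of \<open>f\<close> over the closed intervals from \<open>t i\<close> to \<open>t (Suc i)\<close>; as
  consecutive ones share an endpoint, \<open>f\<close> is automatically continuous.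
\<close>

definition dyadic_piecewise_linear :: "(real \<Rightarrow> real) \<Rightarrow> bool" where
  "dyadic_piecewise_linear f \<longleftrightarrow>
     (\<exists>(n :: nat) (t :: nat \<Rightarrow> real).
        t 0 = 0 \<and> t n = 1 \<and> (\<forall>i<n. t i < t (Suc i)) \<and>
        (\<forall>i\<le>n. t i \<in> dyadic_rationals \<and> f (t i) \<in> dyadic_rationals) \<and>
        (\<forall>i<n. \<exists>k :: int. \<forall>x \<in> {t i..t (Suc i)}. f x = f (t i) + 2 powi k * (x - t i)))"

definition thompson_F :: "(real \<Rightarrow> real) monoid" where
  "thompson_F = (BijGroup {0..1})
     \<lparr>carrier := {f \<in> Bij {0..1}. dyadic_piecewise_linear f}\<rparr>"

end

theory Submission
  imports Defs "HOL-Library.Countable_Set"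
begin

text \<open>
  A binary tree \<open>t\<close> with \<open>n\<close> leaves is a way of bracketing \<open>n\<close> factors, so in any monoidal
  category with an idempotent object \<open>(M, \<mu>)\<close> it yields an isomorphism \<open>M\<^sup>n \<rightarrow> M\<close>
  built from \<open>\<mu>\<close>.  The proof compares two descriptions of pairs of trees with equally many
  leaves: as automorphisms of \<open>A\<close> in the free category, and as piecewise linear bijections.

  For the first description, lists of trees (forests) give isomorphisms between powers of \<open>M\<close>.
  Forest maps compose to forest maps (\<open>forest_graft\<close>) and satisfy the Ore condition, since two
  trees have a common refinement (\<open>forest_ore\<close>).  Hence the fractions of forest maps form a
  monoidal subcategory containing \<open>\<mu>\<close> and its inverse (\<open>fraction_cat_monoidal\<close>).  In the free
  category the universal property forces this subcategory to be everything
  (\<open>free_all_fractions\<close>), so an automorphism of \<open>A\<close> is the fraction of two trees.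

  For the second one, a concrete monoidal category has the natural numbers as objects, where
  \<open>n\<close> stands for the interval \<open>[0, n)\<close>, maps between these intervals as maps, and juxtaposition as
  tensor product.  The halving map \<open>[0, 2) \<rightarrow> [0, 1)\<close> makes the object \<open>1\<close> idempotent.  A tree
  then acts by sending the \<open>i\<close>-th unit interval affinely onto the \<open>i\<close>-th piece of a subdivision of
  \<open>[0, 1)\<close>, and a fraction of two trees becomes an element of Thompson's group
  (\<open>tree_pair_thompson\<close>).

  The universal property provides a monoidal functor between the two, and thereby a homomorphism
  from \<open>Aut(A)\<close> to Thompson's group.  It is injective because the subdivision of a tree determines
  the tree (\<open>tree_fun_eqD\<close>).  It is surjective because every element of Thompson's group is linear
  on the pieces of a sufficiently fine regular subdivision and maps these onto standard dyadic
  intervals, and every subdivision into standard dyadic intervals comes from a tree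
  (\<open>dyadic_partition_tree\<close>, \<open>thompson_tree_pair\<close>).

  The same functor shows that the powers of \<open>A\<close> are distinct.  This is needed to compose
  fractions: the middle object of a composable pair must determine the lengths of its forests.
  The functor is therefore obtained first.  Its target has to be small enough for the universe in
  the universal property, which the countable category of fractions of interval maps is
  (\<open>countable_fractions\<close>).
\<close>

section \<open>Universes for the universal property\<close>

lemma hom_setD:
  assumes "f \<in> hom_set C X Y"
  shows "f \<in> Ar C" "Src\<^bsub>C\<^esub> f = X" "Tgt\<^bsub>C\<^esub> f = Y"
  using assms by (auto simp: hom_set_def)

lemma Ar_hom_set: "f \<in> Ar C \<Longrightarrow> f \<in> hom_set C (Src\<^bsub>C\<^esub> f) (Tgt\<^bsub>C\<^esub> f)"
  by (simp add: hom_set_def)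

lemma (in small_category) hom_set_Ob:
  assumes "f \<in> hom_set C X Y"
  shows "X \<in> Ob C" "Y \<in> Ob C"
  using assms Src_Ob Tgt_Ob by (auto simp: hom_set_def)

text \<open>
  The copy of a category along injections of its objects and its maps into other types.  It serves
  to move a target category into the universe over which the universal property quantifies.
\<close>

definition transport :: "('o \<Rightarrow> 'p) \<Rightarrow> ('m \<Rightarrow> 'q) \<Rightarrow> ('o, 'm) moncat \<Rightarrow> ('p, 'q) moncat" where
  "transport i j D =
     (let i' = inv_into (Ob D) i; j' = inv_into (Ar D) j in
      moncat.make (i ` Ob D) (j ` Ar D)
        (\<lambda>f. i (Src\<^bsub>D\<^esub> (j' f))) (\<lambda>f. i (Tgt\<^bsub>D\<^esub> (j' f)))
        (\<lambda>X. j (Idn\<^bsub>D\<^esub> (i' X))) (\<lambda>g f. j (j' g \<cdot>\<^bsub>D\<^esub> j' f))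
        (\<lambda>X Y. i (i' X \<odot>\<^bsub>D\<^esub> i' Y)) (\<lambda>f g. j (j' f \<boxtimes>\<^bsub>D\<^esub> j' g))
        (i UnitOb\<^bsub>D\<^esub>))"

context
  fixes D :: "('r, 's) moncat" and i :: "'r \<Rightarrow> 'p" and j :: "'s \<Rightarrow> 'q"
  assumes D: "strict_monoidal_category D"
    and inj_i: "inj_on i (Ob D)" and inj_j: "inj_on j (Ar D)"
begin

interpretation D: strict_monoidal_category D by (fact D)

private abbreviation (input) "T \<equiv> transport i j D"

lemma transport_sel:
  "Ob T = i ` Ob D" "Ar T = j ` Ar D"
  "f \<in> Ar D \<Longrightarrow> Src\<^bsub>T\<^esub> (j f) = i (Src\<^bsub>D\<^esub> f)"
  "f \<in> Ar D \<Longrightarrow> Tgt\<^bsub>T\<^esub> (j f) = i (Tgt\<^bsub>D\<^esub> f)"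
  "X \<in> Ob D \<Longrightarrow> Idn\<^bsub>T\<^esub> (i X) = j (Idn\<^bsub>D\<^esub> X)"
  "\<lbrakk>f \<in> Ar D; g \<in> Ar D\<rbrakk> \<Longrightarrow> j g \<cdot>\<^bsub>T\<^esub> j f = j (g \<cdot>\<^bsub>D\<^esub> f)"
  "\<lbrakk>X \<in> Ob D; Y \<in> Ob D\<rbrakk> \<Longrightarrow> i X \<odot>\<^bsub>T\<^esub> i Y = i (X \<odot>\<^bsub>D\<^esub> Y)"
  "\<lbrakk>f \<in> Ar D; g \<in> Ar D\<rbrakk> \<Longrightarrow> j f \<boxtimes>\<^bsub>T\<^esub> j g = j (f \<boxtimes>\<^bsub>D\<^esub> g)"
  "UnitOb\<^bsub>T\<^esub> = i UnitOb\<^bsub>D\<^esub>"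
  using inj_i inj_j by (simp_all add: transport_def Let_def moncat.defs)

lemma transport_homE:
  assumes "f \<in> hom_set T X Y"
  obtains f' X' Y' where "f = j f'" "X = i X'" "Y = i Y'" "f' \<in> hom_set D X' Y'"
    "X' \<in> Ob D" "Y' \<in> Ob D" "f' \<in> Ar D"
  using assms D.Src_Ob D.Tgt_Ob
  by (fastforce simp: hom_set_def transport_sel)

lemma transport_homI: "f \<in> hom_set D X Y \<Longrightarrow> j f \<in> hom_set T (i X) (i Y)"
  by (auto simp: hom_set_def transport_sel)

lemma transport_monoidal: "strict_monoidal_category T"
proof
  show "Src\<^bsub>T\<^esub> f \<in> Ob T" "Tgt\<^bsub>T\<^esub> f \<in> Ob T" if "f \<in> Ar T" for f
    using that D.Src_Ob D.Tgt_Ob by (auto simp: transport_sel)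
  show "Idn\<^bsub>T\<^esub> X \<in> hom_set T X X" if "X \<in> Ob T" for X
    using that D.Idn_hom by (auto simp: transport_sel transport_homI)
  show "UnitOb\<^bsub>T\<^esub> \<in> Ob T" using D.UnitOb_Ob by (simp add: transport_sel)
  show "X \<odot>\<^bsub>T\<^esub> Y \<in> Ob T" if "X \<in> Ob T" "Y \<in> Ob T" for X Y
    using that D.TensOb_Ob by (auto simp: transport_sel)
  show "Idn\<^bsub>T\<^esub> X \<boxtimes>\<^bsub>T\<^esub> Idn\<^bsub>T\<^esub> Y = Idn\<^bsub>T\<^esub> (X \<odot>\<^bsub>T\<^esub> Y)" if "X \<in> Ob T" "Y \<in> Ob T" for X Y
    using that D.Idn_hom[THEN hom_setD(1)] D.Tens_Idn D.TensOb_Ob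
    by (auto simp: transport_sel)
  show "X \<odot>\<^bsub>T\<^esub> Y \<odot>\<^bsub>T\<^esub> Z = X \<odot>\<^bsub>T\<^esub> (Y \<odot>\<^bsub>T\<^esub> Z)"
    if "X \<in> Ob T" "Y \<in> Ob T" "Z \<in> Ob T" for X Y Z
    using that D.TensOb_Ob D.TensOb_assoc by (auto simp: transport_sel)
  show "UnitOb\<^bsub>T\<^esub> \<odot>\<^bsub>T\<^esub> X = X" "X \<odot>\<^bsub>T\<^esub> UnitOb\<^bsub>T\<^esub> = X" if "X \<in> Ob T" for X
    using that D.UnitOb_Ob D.TensOb_unit_left D.TensOb_unit_right by (auto simp: transport_sel)
  have tens: "f \<boxtimes>\<^bsub>D\<^esub> g \<in> Ar D" if "f \<in> Ar D" "g \<in> Ar D" for f g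
    using D.TensAr_hom[OF that[THEN Ar_hom_set]] hom_setD(1) by metis
  show "f \<boxtimes>\<^bsub>T\<^esub> g \<boxtimes>\<^bsub>T\<^esub> h = f \<boxtimes>\<^bsub>T\<^esub> (g \<boxtimes>\<^bsub>T\<^esub> h)"
    if "f \<in> Ar T" "g \<in> Ar T" "h \<in> Ar T" for f g h
    using that tens D.TensAr_assoc by (auto simp: transport_sel)
  have "Idn\<^bsub>D\<^esub> UnitOb\<^bsub>D\<^esub> \<in> Ar D"
    using D.Idn_hom[OF D.UnitOb_Ob] hom_setD(1) by metis
  then show "Idn\<^bsub>T\<^esub> UnitOb\<^bsub>T\<^esub> \<boxtimes>\<^bsub>T\<^esub> f = f" "f \<boxtimes>\<^bsub>T\<^esub> Idn\<^bsub>T\<^esub> UnitOb\<^bsub>T\<^esub> = f" if "f \<in> Ar T" for f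
    using that D.UnitOb_Ob D.TensAr_unit_left D.TensAr_unit_right by (auto simp: transport_sel)
next
  fix f X Y assume "f \<in> hom_set T X Y"
  then show "f \<cdot>\<^bsub>T\<^esub> Idn\<^bsub>T\<^esub> X = f" "Idn\<^bsub>T\<^esub> Y \<cdot>\<^bsub>T\<^esub> f = f"
    by (auto elim!: transport_homE simp: transport_sel D.Idn_hom[THEN hom_setD(1)]
        D.Cmp_Idn_right D.Cmp_Idn_left)
next
  fix f g X Y Z assume fg: "f \<in> hom_set T X Y" "g \<in> hom_set T Y Z"
  from fg(1) obtain f' X' Y' where f: "f = j f'" "X = i X'" "Y = i Y'" "f' \<in> hom_set D X' Y'"
    "Y' \<in> Ob D" "f' \<in> Ar D" by (rule transport_homE)
  from fg(2) obtain g' Z' where g: "g = j g'" "Z = i Z'" "g' \<in> hom_set D Y' Z'" "g' \<in> Ar D"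
    by (rule transport_homE) (metis f(3,5) inj_i inj_onD)
  show "g \<cdot>\<^bsub>T\<^esub> f \<in> hom_set T X Z"
    using f g D.Cmp_hom by (simp add: transport_sel transport_homI)
  {
    fix h W assume h: "h \<in> hom_set T Z W"
    obtain h' W' where h: "h = j h'" "W = i W'" "h' \<in> hom_set D Z' W'" "h' \<in> Ar D"
      using h by (rule transport_homE) (metis D.hom_set_Ob(2) g(2,3) inj_i inj_onD)
    show "h \<cdot>\<^bsub>T\<^esub> g \<cdot>\<^bsub>T\<^esub> f = h \<cdot>\<^bsub>T\<^esub> (g \<cdot>\<^bsub>T\<^esub> f)"
      using f g h D.Cmp_hom[THEN hom_setD(1)] D.Cmp_assoc by (simp add: transport_sel)
  }
  fix f2 g2 X2 Y2 Z2 assume fg2: "f2 \<in> hom_set T X2 Y2" "g2 \<in> hom_set T Y2 Z2"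
  from fg2(1) obtain f2' X2' Y2' where f2: "f2 = j f2'" "X2 = i X2'" "Y2 = i Y2'"
    "f2' \<in> hom_set D X2' Y2'" "Y2' \<in> Ob D" "f2' \<in> Ar D" by (rule transport_homE)
  from fg2(2) obtain g2' Z2' where g2: "g2 = j g2'" "Z2 = i Z2'" "g2' \<in> hom_set D Y2' Z2'"
    "g2' \<in> Ar D" by (rule transport_homE) (metis f2(3,5) inj_i inj_onD)
  show "(g \<cdot>\<^bsub>T\<^esub> f) \<boxtimes>\<^bsub>T\<^esub> (g2 \<cdot>\<^bsub>T\<^esub> f2) = g \<boxtimes>\<^bsub>T\<^esub> g2 \<cdot>\<^bsub>T\<^esub> f \<boxtimes>\<^bsub>T\<^esub> f2"
    using f g f2 g2 D.Cmp_hom[THEN hom_setD(1)] D.TensAr_hom[THEN hom_setD(1)] D.Tens_Cmp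
    by (simp add: transport_sel)
next
  fix f X Y f' X' Y' assume "f \<in> hom_set T X Y" "f' \<in> hom_set T X' Y'"
  then show "f \<boxtimes>\<^bsub>T\<^esub> f' \<in> hom_set T (X \<odot>\<^bsub>T\<^esub> X') (Y \<odot>\<^bsub>T\<^esub> Y')"
    by (elim transport_homE) (simp add: transport_sel transport_homI D.TensAr_hom)
qed

lemma functor_to_transport: "strict_monoidal_functor D T i j"
proof -
  interpret T: strict_monoidal_category T by (fact transport_monoidal)
  show ?thesis
    by unfold_locales
      (auto simp: transport_sel(1-5,7-9) transport_sel(6)[OF hom_setD(1) hom_setD(1)] transport_homI)
qed

lemma functor_from_transport:
  "strict_monoidal_functor T D (inv_into (Ob D) i) (inv_into (Ar D) j)"
proof -
  interpret T: strict_monoidal_category T by (fact transport_monoidal)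
  have [simp]: "X \<in> Ob D \<Longrightarrow> inv_into (Ob D) i (i X) = X" for X
    using inj_i by simp
  have [simp]: "f \<in> Ar D \<Longrightarrow> inv_into (Ar D) j (j f) = f" for f
    using inj_j by simp
  have tens: "f \<boxtimes>\<^bsub>D\<^esub> g \<in> Ar D" if "f \<in> Ar D" "g \<in> Ar D" for f g
    using D.TensAr_hom[OF that[THEN Ar_hom_set]] hom_setD(1) by metis
  show ?thesis
  proof
    fix f g X Y Z assume fg: "f \<in> hom_set T X Y" "g \<in> hom_set T Y Z"
    from fg(1) obtain f' X' Y' where f: "f = j f'" "X = i X'" "Y = i Y'" "f' \<in> hom_set D X' Y'"
      "Y' \<in> Ob D" "f' \<in> Ar D" by (rule transport_homE)
    from fg(2) obtain g' Z' where g: "g = j g'" "Z = i Z'" "g' \<in> hom_set D Y' Z'" "g' \<in> Ar D"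
      by (rule transport_homE) (metis f(3,5) inj_i inj_onD)
    show "inv_into (Ar D) j (g \<cdot>\<^bsub>T\<^esub> f) = inv_into (Ar D) j g \<cdot>\<^bsub>D\<^esub> inv_into (Ar D) j f"
      using f g D.Cmp_hom[THEN hom_setD(1)] by (simp add: transport_sel)
  qed (auto simp: transport_sel D.TensOb_Ob tens D.UnitOb_Ob D.Idn_hom[THEN hom_setD(1)]
      elim!: transport_homE)
qed

end

lemma strict_monoidal_functor_comp:
  assumes "strict_monoidal_functor C D Fo Fa" "strict_monoidal_functor D E Go Ga"
  shows "strict_monoidal_functor C E (Go \<circ> Fo) (Ga \<circ> Fa)"
proof -
  interpret F: strict_monoidal_functor C D Fo Fa by fact
  interpret G: strict_monoidal_functor D E Go Ga by fact
  have Ar: "Fa f \<in> Ar D" if "f \<in> Ar C" for f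
    using F.Fa_hom[OF Ar_hom_set[OF that]] hom_setD(1) by metis
  show ?thesis
    by unfold_locales
      (auto simp: F.Fo_Ob G.Fo_Ob F.Fa_Idn G.Fa_Idn F.Fo_Tens G.Fo_Tens F.Fa_Tens G.Fa_Tens
        F.Fo_Unit G.Fo_Unit Ar F.Fa_Cmp G.Fa_Cmp[OF F.Fa_hom F.Fa_hom]
        intro: F.Fa_hom G.Fa_hom)
qed

lemma (in strict_monoidal_functor) Fa_iso:
  assumes "f \<in> iso_set C X Y"
  shows "Fa f \<in> iso_set D (Fo X) (Fo Y)"
proof -
  obtain g where f: "f \<in> hom_set C X Y" and g: "g \<in> hom_set C Y X"
    and "g \<cdot>\<^bsub>C\<^esub> f = Idn\<^bsub>C\<^esub> X" "f \<cdot>\<^bsub>C\<^esub> g = Idn\<^bsub>C\<^esub> Y"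
    using assms by (auto simp: iso_set_def)
  then have "Fa g \<cdot>\<^bsub>D\<^esub> Fa f = Idn\<^bsub>D\<^esub> (Fo X)" "Fa f \<cdot>\<^bsub>D\<^esub> Fa g = Idn\<^bsub>D\<^esub> (Fo Y)"
    by (metis Fa_Cmp Fa_Idn C.hom_set_Ob(1))+
  then show ?thesis using Fa_hom[OF f] Fa_hom[OF g] by (auto simp: iso_set_def)
qed

lemma (in strict_monoidal_functor) idempotent_image:
  assumes "idempotent_object C M \<mu>"
  shows "idempotent_object D (Fo M) (Fa \<mu>)"
proof -
  have M: "M \<in> Ob C" and \<mu>: "\<mu> \<in> iso_set C (M \<odot>\<^bsub>C\<^esub> M) M"
    using assms by (auto simp: idempotent_object_def)
  have "Fa \<mu> \<in> iso_set D (Fo (M \<odot>\<^bsub>C\<^esub> M)) (Fo M)"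
    by (rule Fa_iso[OF \<mu>])
  then show ?thesis using M Fo_Ob Fo_Tens by (simp add: idempotent_object_def)
qed

text \<open>
  For a target over arbitrary types, apply the universal property to a copy in the given universe
  and compose with the isomorphism between the target and its copy.
\<close>

lemma
  fixes C :: "('o, 'm) moncat" and D :: "('r, 's) moncat"
    and i :: "'r \<Rightarrow> 'p" and j :: "'s \<Rightarrow> 'q"
  assumes free: "freely_generated_by_idempotent TYPE('p) TYPE('q) C A \<alpha>"
    and D: "strict_monoidal_category D" and inj: "inj_on i (Ob D)" "inj_on j (Ar D)"
  shows free_functor_exists: "idempotent_object D M \<mu> \<Longrightarrow>
      \<exists>Go Ga. strict_monoidal_functor C D Go Ga \<and> Go A = M \<and> Ga \<alpha> = \<mu>"
    and free_functor_unique: "\<lbrakk>strict_monoidal_functor C D Go Ga; strict_monoidal_functor C D Ho Ha;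
      Go A = Ho A; Ga \<alpha> = Ha \<alpha>; f \<in> Ar C\<rbrakk> \<Longrightarrow> Ga f = Ha f"
proof -
  let ?T = "transport i j D"
  have T: "strict_monoidal_category ?T" by (rule transport_monoidal[OF D inj])
  interpret to: strict_monoidal_functor D ?T i j by (rule functor_to_transport[OF D inj])
  have univ: "\<And>N \<nu>. idempotent_object ?T N \<nu> \<Longrightarrow>
     \<exists>Go Ga. strict_monoidal_functor C ?T Go Ga \<and> Go A = N \<and> Ga \<alpha> = \<nu> \<and>
        (\<forall>Ho Ha. strict_monoidal_functor C ?T Ho Ha \<and> Ho A = N \<and> Ha \<alpha> = \<nu> \<longrightarrow>
           (\<forall>X \<in> Ob C. Ho X = Go X) \<and> (\<forall>f \<in> Ar C. Ha f = Ga f))"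
    using free T unfolding freely_generated_by_idempotent_def by blast
  have idem: "idempotent_object C A \<alpha>" and "strict_monoidal_category C"
    using free unfolding freely_generated_by_idempotent_def by auto
  interpret C: strict_monoidal_category C by fact
  show "\<exists>Go Ga. strict_monoidal_functor C D Go Ga \<and> Go A = M \<and> Ga \<alpha> = \<mu>"
    if M: "idempotent_object D M \<mu>"
  proof -
    obtain Go Ga where G: "strict_monoidal_functor C ?T Go Ga" "Go A = i M" "Ga \<alpha> = j \<mu>"
      using univ[OF to.idempotent_image[OF M]] by blast
    have "M \<in> Ob D" "\<mu> \<in> Ar D"
      using M by (auto simp: idempotent_object_def iso_set_def hom_set_def)
    then have "(inv_into (Ob D) i \<circ> Go) A = M" "(inv_into (Ar D) j \<circ> Ga) \<alpha> = \<mu>"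
      using inj G(2,3) by auto
    then show ?thesis
      using strict_monoidal_functor_comp[OF G(1) functor_from_transport[OF D inj]] by blast
  qed
  show "Ga f = Ha f"
    if G: "strict_monoidal_functor C D Go Ga" and H: "strict_monoidal_functor C D Ho Ha"
      and eq: "Go A = Ho A" "Ga \<alpha> = Ha \<alpha>" and f: "f \<in> Ar C"
  proof -
    interpret G: strict_monoidal_functor C D Go Ga by fact
    interpret H: strict_monoidal_functor C D Ho Ha by fact
    have "idempotent_object ?T (i (Go A)) (j (Ga \<alpha>))"
      using idem G.idempotent_image to.idempotent_image by blast
    then have "j (Ga f) = j (Ha f)"
      using univ[of "i (Go A)" "j (Ga \<alpha>)"] f eq
        strict_monoidal_functor_comp[OF G to.strict_monoidal_functor_axioms]
        strict_monoidal_functor_comp[OF H to.strict_monoidal_functor_axioms]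
      by (metis comp_apply)
    moreover have "Ga f \<in> Ar D" "Ha f \<in> Ar D"
      using G.Fa_hom[OF Ar_hom_set[OF f]] H.Fa_hom[OF Ar_hom_set[OF f]] by (auto simp: hom_set_def)
    ultimately show ?thesis using inj(2) by (auto dest: inj_onD)
  qed
qed

section \<open>Fractions of forests\<close>

datatype btree = Leaf | Node btree btree

instance btree :: countable by countable_datatype

primrec leaves :: "btree \<Rightarrow> nat" where
  "leaves Leaf = 1"
| "leaves (Node l r) = leaves l + leaves r"

abbreviation width :: "btree list \<Rightarrow> nat" where
  "width ts \<equiv> sum_list (map leaves ts)"

lemma leaves_pos: "0 < leaves t"
  by (induction t) auto

lemma leaves_eq_1: "leaves t = 1 \<longleftrightarrow> t = Leaf"
proof (cases t)
  case (Node l r)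
  then show ?thesis using leaves_pos[of l] leaves_pos[of r] by simp
qed simp

primrec obj_power :: "('o, 'm) moncat \<Rightarrow> 'o \<Rightarrow> nat \<Rightarrow> 'o" where
  "obj_power C M 0 = UnitOb\<^bsub>C\<^esub>"
| "obj_power C M (Suc n) = M \<odot>\<^bsub>C\<^esub> obj_power C M n"

primrec tree_map :: "('o, 'm) moncat \<Rightarrow> 'o \<Rightarrow> 'm \<Rightarrow> btree \<Rightarrow> 'm" where
  "tree_map C M \<mu> Leaf = Idn\<^bsub>C\<^esub> M"
| "tree_map C M \<mu> (Node l r) = \<mu> \<cdot>\<^bsub>C\<^esub> (tree_map C M \<mu> l \<boxtimes>\<^bsub>C\<^esub> tree_map C M \<mu> r)"

primrec forest_map :: "('o, 'm) moncat \<Rightarrow> 'o \<Rightarrow> 'm \<Rightarrow> btree list \<Rightarrow> 'm" where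
  "forest_map C M \<mu> [] = Idn\<^bsub>C\<^esub> UnitOb\<^bsub>C\<^esub>"
| "forest_map C M \<mu> (t # ts) = tree_map C M \<mu> t \<boxtimes>\<^bsub>C\<^esub> forest_map C M \<mu> ts"

text \<open>
  Since forest maps are isomorphisms, the equation says that \<open>f\<close> is the inverse of the map of \<open>ts\<close>
  followed by the map of \<open>us\<close>.
\<close>

definition fractions :: "('o, 'm) moncat \<Rightarrow> 'o \<Rightarrow> 'm \<Rightarrow> 'm set" where
  "fractions C M \<mu> = {f. \<exists>ts us. width ts = width us \<and>
     f \<in> hom_set C (obj_power C M (length ts)) (obj_power C M (length us)) \<and>
     f \<cdot>\<^bsub>C\<^esub> forest_map C M \<mu> ts = forest_map C M \<mu> us}"

definition fraction_cat :: "('o, 'm) moncat \<Rightarrow> 'o \<Rightarrow> 'm \<Rightarrow> ('o, 'm) moncat" where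
  "fraction_cat C M \<mu> = C\<lparr>Ob := range (obj_power C M), Ar := fractions C M \<mu>\<rparr>"

context strict_monoidal_category
begin

lemma iso_setE:
  assumes "f \<in> iso_set C X Y"
  obtains g where "f \<in> hom_set C X Y" "g \<in> hom_set C Y X" "g \<cdot> f = Idn X" "f \<cdot> g = Idn Y"
    "g \<in> iso_set C Y X"
  using assms by (auto simp: iso_set_def)

lemma Idn_iso: "X \<in> Ob C \<Longrightarrow> Idn X \<in> iso_set C X X"
  using Idn_hom Cmp_Idn_left by (auto simp: iso_set_def)

lemma Cmp_iso:
  assumes f: "f \<in> iso_set C X Y" and g: "g \<in> iso_set C Y Z"
  shows "g \<cdot> f \<in> iso_set C X Z"
proof -
  obtain f' where f: "f \<in> hom_set C X Y" "f' \<in> hom_set C Y X" "f' \<cdot> f = Idn X" "f \<cdot> f' = Idn Y"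
    using f by (rule iso_setE)
  obtain g' where g: "g \<in> hom_set C Y Z" "g' \<in> hom_set C Z Y" "g' \<cdot> g = Idn Y" "g \<cdot> g' = Idn Z"
    using g by (rule iso_setE)
  have "(f' \<cdot> g') \<cdot> (g \<cdot> f) = f' \<cdot> ((g' \<cdot> g) \<cdot> f)"
    using Cmp_assoc[OF Cmp_hom[OF f(1) g(1)] g(2) f(2)] Cmp_assoc[OF f(1) g(1) g(2)] by simp
  moreover have "(g \<cdot> f) \<cdot> (f' \<cdot> g') = g \<cdot> ((f \<cdot> f') \<cdot> g')"
    using Cmp_assoc[OF Cmp_hom[OF g(2) f(2)] f(1) g(1)] Cmp_assoc[OF g(2) f(2) f(1)] by simp
  ultimately show ?thesis
    using f g Cmp_hom[OF f(1) g(1)] Cmp_hom[OF g(2) f(2)]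
    by (auto simp: iso_set_def Cmp_Idn_left)
qed

lemma Tens_iso:
  assumes f: "f \<in> iso_set C X Y" and g: "g \<in> iso_set C X' Y'"
  shows "f \<boxtimes> g \<in> iso_set C (X \<odot> X') (Y \<odot> Y')"
proof -
  obtain f' where f: "f \<in> hom_set C X Y" "f' \<in> hom_set C Y X" "f' \<cdot> f = Idn X" "f \<cdot> f' = Idn Y"
    using f by (rule iso_setE)
  obtain g' where g: "g \<in> hom_set C X' Y'" "g' \<in> hom_set C Y' X'" "g' \<cdot> g = Idn X'"
    "g \<cdot> g' = Idn Y'"
    using g by (rule iso_setE)
  have "(f' \<boxtimes> g') \<cdot> (f \<boxtimes> g) = Idn (X \<odot> X')" "(f \<boxtimes> g) \<cdot> (f' \<boxtimes> g') = Idn (Y \<odot> Y')"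
    using Tens_Cmp[OF f(1,2) g(1,2)] Tens_Cmp[OF f(2,1) g(2,1)] f(3,4) g(3,4)
      Tens_Idn hom_set_Ob[OF f(1)] hom_set_Ob[OF g(1)] by simp_all
  then show ?thesis
    using TensAr_hom[OF f(1) g(1)] TensAr_hom[OF f(2) g(2)] by (auto simp: iso_set_def)
qed

lemma iso_cancel_right:
  assumes "p \<in> iso_set C X Y" "f \<in> hom_set C Y Z" "g \<in> hom_set C Y Z" "f \<cdot> p = g \<cdot> p"
  shows "f = g"
proof -
  obtain q where p: "p \<in> hom_set C X Y" and q: "q \<in> hom_set C Y X" "p \<cdot> q = Idn Y"
    using assms(1) by (rule iso_setE)
  have "f = (f \<cdot> p) \<cdot> q" "g = (g \<cdot> p) \<cdot> q"
    using Cmp_assoc[OF q(1) p] q(2) Cmp_Idn_right assms(2,3) by simp_all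
  then show ?thesis using assms(4) by simp
qed

end

locale monoidal_idempotent = strict_monoidal_category C
  for C :: "('o, 'm) moncat" (structure) +
  fixes M :: 'o and \<mu> :: 'm
  assumes idempotent: "idempotent_object C M \<mu>"
begin

abbreviation "mpow \<equiv> obj_power C M"
abbreviation "tree \<equiv> tree_map C M \<mu>"
abbreviation "forest \<equiv> forest_map C M \<mu>"

lemma M_Ob: "M \<in> Ob C"
  using idempotent by (simp add: idempotent_object_def)

lemma \<mu>_iso: "\<mu> \<in> iso_set C (M \<odot> M) M"
  using idempotent by (simp add: idempotent_object_def)

lemma \<mu>_hom: "\<mu> \<in> hom_set C (M \<odot> M) M"
  using \<mu>_iso by (simp add: iso_set_def)

lemma mpow_Ob: "mpow n \<in> Ob C"
  by (induction n) (auto simp: UnitOb_Ob M_Ob TensOb_Ob)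

lemma mpow_add: "mpow (m + n) = mpow m \<odot> mpow n"
  by (induction m) (auto simp: TensOb_unit_left mpow_Ob TensOb_assoc M_Ob)

lemma mpow_1: "mpow 1 = M"
  by (simp add: TensOb_unit_right M_Ob)

lemma mpow_2: "mpow 2 = M \<odot> M"
  by (simp add: numeral_2_eq_2 TensOb_unit_right M_Ob)

lemma tree_iso: "tree t \<in> iso_set C (mpow (leaves t)) M"
  by (induction t)
    (use Idn_iso[OF M_Ob] mpow_1 in \<open>auto simp: mpow_add intro!: Cmp_iso[OF Tens_iso \<mu>_iso]\<close>)

lemma forest_iso: "forest ts \<in> iso_set C (mpow (width ts)) (mpow (length ts))"
  by (induction ts) (auto simp: mpow_add Idn_iso UnitOb_Ob intro: Tens_iso tree_iso)

lemma tree_hom: "tree t \<in> hom_set C (mpow (leaves t)) M"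
  using tree_iso by (simp add: iso_set_def)

lemma forest_hom: "forest ts \<in> hom_set C (mpow (width ts)) (mpow (length ts))"
  using forest_iso by (simp add: iso_set_def)

lemma forest_hom':
  "\<lbrakk>width ts = m; length ts = n\<rbrakk> \<Longrightarrow> forest ts \<in> hom_set C (mpow m) (mpow n)"
  using forest_hom by blast

lemma forest_single: "forest [t] = tree t"
  using TensAr_unit_right tree_hom hom_setD(1) by fastforce

lemma forest_append: "forest (ts @ us) = forest ts \<boxtimes> forest us"
  by (induction ts)
    (auto simp: TensAr_unit_left TensAr_assoc hom_setD(1)[OF tree_hom] hom_setD(1)[OF forest_hom])

lemma forest_replicate_Leaf: "forest (replicate n Leaf) = Idn (mpow n)"
  by (induction n) (auto simp: Tens_Idn M_Ob mpow_Ob)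

lemma split_forest:
  assumes "length us = m + n"
  obtains vs ws where "us = vs @ ws" "length vs = m" "length ws = n"
  using assms by (metis append_take_drop_id add_diff_cancel_left' length_drop length_take le_add1 min.absorb2)

text \<open>
  The composite is the map of the tree \<open>t\<close> with the trees \<open>us\<close> grafted onto its leaves: functoriality
  of the tensor product distributes \<open>us\<close> over the two subtrees of a node.
\<close>

lemma tree_graft:
  "length us = leaves t \<Longrightarrow> \<exists>v. leaves v = width us \<and> tree t \<cdot> forest us = tree v"
proof (induction t arbitrary: us)
  case Leaf
  then obtain u where "us = [u]" by (auto simp: length_Suc_conv)
  then show ?case
    using forest_single Cmp_Idn_left[OF tree_hom] by auto
next
  case (Node l r)
  then obtain vs ws where us: "us = vs @ ws" "length vs = leaves l" "length ws = leaves r"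
    by (auto elim: split_forest)
  obtain v where v: "leaves v = width vs" "tree l \<cdot> forest vs = tree v" using Node.IH(1) us by blast
  obtain w where w: "leaves w = width ws" "tree r \<cdot> forest ws = tree w" using Node.IH(2) us by blast
  have vs: "forest vs \<in> hom_set C (mpow (width vs)) (mpow (leaves l))"
    and ws: "forest ws \<in> hom_set C (mpow (width ws)) (mpow (leaves r))"
    using us by (auto intro: forest_hom')
  have "tree (Node l r) \<cdot> forest us = \<mu> \<cdot> ((tree l \<boxtimes> tree r) \<cdot> (forest vs \<boxtimes> forest ws))"
    using Cmp_assoc[OF TensAr_hom[OF vs ws] TensAr_hom[OF tree_hom tree_hom] \<mu>_hom]
    by (simp add: us forest_append)
  also have "\<dots> = tree (Node v w)"
    using Tens_Cmp[OF vs tree_hom ws tree_hom] v w by simp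
  finally show ?case using us v w by (intro exI[of _ "Node v w"]) auto
qed

lemma forest_graft:
  "length us = width ts \<Longrightarrow>
    \<exists>vs. length vs = length ts \<and> width vs = width us \<and> forest ts \<cdot> forest us = forest vs"
proof (induction ts arbitrary: us)
  case Nil
  then show ?case using Cmp_Idn_left[OF Idn_hom[OF UnitOb_Ob]] by auto
next
  case (Cons t ts)
  then obtain xs ys where us: "us = xs @ ys" "length xs = leaves t" "length ys = width ts"
    by (auto elim: split_forest)
  obtain x where x: "leaves x = width xs" "tree t \<cdot> forest xs = tree x" using tree_graft us by blast
  obtain vs where v: "length vs = length ts" "width vs = width ys" "forest ts \<cdot> forest ys = forest vs"
    using Cons.IH us by blast
  have xs: "forest xs \<in> hom_set C (mpow (width xs)) (mpow (leaves t))"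
    and ys: "forest ys \<in> hom_set C (mpow (width ys)) (mpow (width ts))"
    using us by (auto intro: forest_hom')
  have "forest (t # ts) \<cdot> forest us = forest (x # vs)"
    using Tens_Cmp[OF xs tree_hom ys forest_hom] x v us by (simp add: forest_append)
  then show ?case using us x v by (intro exI[of _ "x # vs"]) auto
qed

text \<open>
  A single leaf is refined to \<open>u\<close> by grafting \<open>u\<close> onto it, while \<open>u\<close> itself stays as it is.
\<close>

lemma tree_ore_Leaf:
  "\<exists>vs ws. length vs = 1 \<and> length ws = leaves u \<and> width vs = width ws \<and>
     tree Leaf \<cdot> forest vs = tree u \<cdot> forest ws"
  using forest_single[of u] forest_replicate_Leaf[of "leaves u"]
    Cmp_Idn_left[OF tree_hom, of u] Cmp_Idn_right[OF tree_hom, of u]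
  by - (rule exI[of _ "[u]"], rule exI[of _ "replicate (leaves u) Leaf"],
    simp add: sum_list_replicate)

text \<open>
  Any two trees have a common refinement: refine the subtrees recursively, and where one tree has
  a leaf, insert the other tree.
\<close>

lemma tree_ore:
  "\<exists>vs ws. length vs = leaves t \<and> length ws = leaves u \<and> width vs = width ws \<and>
     tree t \<cdot> forest vs = tree u \<cdot> forest ws"
proof (induction t arbitrary: u)
  case Leaf
  then show ?case using tree_ore_Leaf by simp
next
  case (Node l r)
  show ?case
  proof (cases u)
    case u: Leaf
    then show ?thesis using tree_ore_Leaf[of "Node l r"] by (metis leaves.simps(1))
  next
    case u: (Node l' r')
    obtain v w where l: "length v = leaves l" "length w = leaves l'" "width v = width w"
      "tree l \<cdot> forest v = tree l' \<cdot> forest w" using Node.IH(1) by blast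
    obtain v' w' where r: "length v' = leaves r" "length w' = leaves r'" "width v' = width w'"
      "tree r \<cdot> forest v' = tree r' \<cdot> forest w'" using Node.IH(2) by blast
    have node: "tree (Node a b) \<cdot> forest (p @ q) = \<mu> \<cdot> ((tree a \<cdot> forest p) \<boxtimes> (tree b \<cdot> forest q))"
      if p: "length p = leaves a" and q: "length q = leaves b" for a b p q
    proof -
      have p: "forest p \<in> hom_set C (mpow (width p)) (mpow (leaves a))"
        and q: "forest q \<in> hom_set C (mpow (width q)) (mpow (leaves b))"
        using p q by (auto intro: forest_hom')
      show ?thesis
        using Cmp_assoc[OF TensAr_hom[OF p q] TensAr_hom[OF tree_hom tree_hom] \<mu>_hom]
          Tens_Cmp[OF p tree_hom q tree_hom] by (simp add: forest_append)
    qed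
    show ?thesis
      using l r u node[OF l(1) r(1)] node[OF l(2) r(2)]
      by - (rule exI[of _ "v @ v'"], rule exI[of _ "w @ w'"], simp del: tree_map.simps)
  qed
qed

lemma forest_ore:
  "length ts = length us \<Longrightarrow>
    \<exists>vs ws. length vs = width ts \<and> length ws = width us \<and> width vs = width ws \<and>
      forest ts \<cdot> forest vs = forest us \<cdot> forest ws"
proof (induction ts us rule: list_induct2)
  case Nil
  then show ?case by (intro exI[of _ "[]"]) auto
next
  case (Cons t ts u us)
  obtain v w where 1: "length v = leaves t" "length w = leaves u" "width v = width w"
      "tree t \<cdot> forest v = tree u \<cdot> forest w" using tree_ore by blast
  obtain v' w' where 2: "length v' = width ts" "length w' = width us" "width v' = width w'"
      "forest ts \<cdot> forest v' = forest us \<cdot> forest w'" using Cons.IH by blast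
  have node: "forest (a # b) \<cdot> forest (p @ q) = (tree a \<cdot> forest p) \<boxtimes> (forest b \<cdot> forest q)"
    if p: "length p = leaves a" and q: "length q = width b" for a b p q
    using Tens_Cmp[OF forest_hom'[OF refl p] tree_hom forest_hom'[OF refl q] forest_hom]
    by (simp add: forest_append)
  show ?case
    using 1 2 node[OF 1(1) 2(1)] node[OF 1(2) 2(2)]
    by - (rule exI[of _ "v @ v'"], rule exI[of _ "w @ w'"], simp del: forest_map.simps)
qed

lemma fractionsI:
  assumes "f \<cdot> forest ts = forest us" "f \<in> hom_set C (mpow (length ts)) (mpow (length us))"
    "width ts = width us"
  shows "f \<in> fractions C M \<mu>"
  using assms by (auto simp: fractions_def)

lemma fractionsE:
  assumes "f \<in> fractions C M \<mu>"
  obtains ts us where "width ts = width us"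
    "f \<in> hom_set C (mpow (length ts)) (mpow (length us))"
    "f \<cdot> forest ts = forest us" "f \<in> Ar C"
  using assms by (auto simp: fractions_def dest: hom_setD(1))

lemma Idn_fraction: "Idn (mpow n) \<in> fractions C M \<mu>"
  using Cmp_Idn_left[OF forest_hom, of "replicate n Leaf"] Idn_hom[OF mpow_Ob, of n]
  by (intro fractionsI[of _ "replicate n Leaf" "replicate n Leaf"]) auto

lemma Tens_fraction:
  assumes "f \<in> fractions C M \<mu>" "g \<in> fractions C M \<mu>"
  shows "f \<boxtimes> g \<in> fractions C M \<mu>"
proof -
  obtain ts us where f: "width ts = width us"
    "f \<in> hom_set C (mpow (length ts)) (mpow (length us))" "f \<cdot> forest ts = forest us"
    using assms(1) by (rule fractionsE)
  obtain vs ws where g: "width vs = width ws"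
    "g \<in> hom_set C (mpow (length vs)) (mpow (length ws))" "g \<cdot> forest vs = forest ws"
    using assms(2) by (rule fractionsE)
  show ?thesis
    using f g Tens_Cmp[OF forest_hom f(2) forest_hom g(2)] TensAr_hom[OF f(2) g(2)]
    by (intro fractionsI[of _ "ts @ vs" "us @ ws"]) (auto simp: forest_append mpow_add)
qed

lemma \<mu>_fraction: "\<mu> \<in> fractions C M \<mu>"
proof -
  have "\<mu> \<cdot> forest [Leaf, Leaf] = forest [Node Leaf Leaf]"
    using forest_append[of "[Leaf]" "[Leaf]"] forest_single[of Leaf]
      forest_single[of "Node Leaf Leaf"] by simp
  then show ?thesis
    by (rule fractionsI) (use \<mu>_hom mpow_2 mpow_1 in \<open>simp_all add: numeral_2_eq_2\<close>)
qed

text \<open>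
  The inverse of a fraction is the fraction with the two forests exchanged.
\<close>

lemma iso_inverse_fraction:
  assumes f: "f \<in> fractions C M \<mu>" and g: "g \<in> hom_set C Y X" "g \<cdot> f = Idn X"
    "f \<in> hom_set C X Y"
  shows "g \<in> fractions C M \<mu>"
proof -
  obtain ts us where tu: "width ts = width us"
    "f \<in> hom_set C (mpow (length ts)) (mpow (length us))" "f \<cdot> forest ts = forest us"
    using f by (rule fractionsE)
  then have X: "X = mpow (length ts)" and Y: "Y = mpow (length us)"
    using g(3) by (auto simp: hom_set_def)
  have "g \<cdot> forest us = (g \<cdot> f) \<cdot> forest ts"
    using g(1) tu Cmp_assoc[OF forest_hom tu(2)] X Y by simp
  also have "\<dots> = forest ts"
    using g(2) X Cmp_Idn_left[OF forest_hom] by simp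
  finally show ?thesis
    using g(1) X Y tu(1) by (intro fractionsI[of _ us ts]) auto
qed

text \<open>
  A fraction is determined by its two forests, because forest maps are invertible; and there are
  only countably many pairs of forests.
\<close>

lemma countable_fractions: "countable (fractions C M \<mu>)"
proof -
  define frac where "frac = (\<lambda>(ts, us). THE f. f \<in> hom_set C (mpow (length ts)) (mpow (length us)) \<and>
    f \<cdot> forest ts = forest us)"
  have "f \<in> range frac" if "f \<in> fractions C M \<mu>" for f
  proof -
    from that obtain ts us where f: "f \<in> hom_set C (mpow (length ts)) (mpow (length us))"
      "f \<cdot> forest ts = forest us"
      by (rule fractionsE)
    then have "frac (ts, us) = f"
      unfolding frac_def using iso_cancel_right[OF forest_iso]
      by (auto intro!: the_equality)
    then show ?thesis by (metis rangeI)
  qed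
  moreover have "countable (range frac)" by simp
  ultimately show ?thesis by (meson countable_subset subsetI)
qed

end

section \<open>The monoidal subcategory of fractions\<close>

text \<open>
  If two powers of \<open>M\<close> coincide, then the target of one fraction can equal the source of
  another although the forests to be matched have different lengths, and the Ore condition says
  nothing about such a pair.
\<close>

locale monoidal_idempotent_inj = monoidal_idempotent +
  assumes inj_mpow: "inj mpow"
begin

lemma fractions_Ar: "f \<in> fractions C M \<mu> \<Longrightarrow> f \<in> Ar C"
  by (rule fractionsE)

text \<open>
  The usual composition of fractions: with \<open>f = us / ts\<close> and \<open>g = ws / vs\<close>, the Ore condition
  extends \<open>us\<close> and \<open>vs\<close> to a common forest map, and extending \<open>ts\<close> and \<open>ws\<close> in the same way
  gives the two forests of the composite.
\<close>

lemma Cmp_fraction: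
  assumes "f \<in> fractions C M \<mu>" "g \<in> fractions C M \<mu>" "f \<in> hom_set C X Y" "g \<in> hom_set C Y Z"
  shows "g \<cdot> f \<in> fractions C M \<mu>"
proof -
  obtain ts us where f: "width ts = width us"
    "f \<in> hom_set C (mpow (length ts)) (mpow (length us))" "f \<cdot> forest ts = forest us"
    using assms(1) by (rule fractionsE)
  obtain vs ws where g: "width vs = width ws"
    "g \<in> hom_set C (mpow (length vs)) (mpow (length ws))" "g \<cdot> forest vs = forest ws"
    using assms(2) by (rule fractionsE)
  have "mpow (length us) = mpow (length vs)"
    using f(2) g(2) assms(3,4) by (auto simp: hom_set_def)
  then have len: "length us = length vs"
    using inj_mpow by (auto dest: injD)
  then obtain ps qs where pq: "length ps = width us" "length qs = width vs" "width ps = width qs"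
    "forest us \<cdot> forest ps = forest vs \<cdot> forest qs"
    using forest_ore by blast
  obtain as where as: "length as = length ts" "width as = width ps" "forest ts \<cdot> forest ps = forest as"
    using forest_graft[of ps ts] pq(1) f(1) by auto
  obtain bs where bs: "length bs = length ws" "width bs = width qs" "forest ws \<cdot> forest qs = forest bs"
    using forest_graft[of qs ws] pq(2) g(1) by auto
  have ps: "forest ps \<in> hom_set C (mpow (width ps)) (mpow (width us))"
    "forest ps \<in> hom_set C (mpow (width ps)) (mpow (width ts))"
    and qs: "forest qs \<in> hom_set C (mpow (width qs)) (mpow (width vs))"
    using pq f by (auto intro: forest_hom')
  have g': "g \<in> hom_set C (mpow (length us)) (mpow (length ws))"
    using g(2) len by simp
  have "(g \<cdot> f) \<cdot> forest as = g \<cdot> (f \<cdot> (forest ts \<cdot> forest ps))"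
    using Cmp_assoc[OF _ f(2) g'] forest_hom'[OF as(2,1)] as(3) by simp
  also have "\<dots> = g \<cdot> (forest us \<cdot> forest ps)"
    using Cmp_assoc[OF ps(2) forest_hom f(2)] f(3) by simp
  also have "\<dots> = forest bs"
    using Cmp_assoc[OF qs forest_hom g(2)] g(3) pq(4) bs(3) by simp
  finally show ?thesis
    using Cmp_hom[OF f(2) g'] as bs pq(3) by (intro fractionsI[of _ as bs]) auto
qed

lemma fraction_cat_sel:
  "Ob (fraction_cat C M \<mu>) = range mpow" "Ar (fraction_cat C M \<mu>) = fractions C M \<mu>"
  "Src\<^bsub>fraction_cat C M \<mu>\<^esub> = Src" "Tgt\<^bsub>fraction_cat C M \<mu>\<^esub> = Tgt" "Idn\<^bsub>fraction_cat C M \<mu>\<^esub> = Idn"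
  "Cmp (fraction_cat C M \<mu>) = Cmp C" "TensOb (fraction_cat C M \<mu>) = TensOb C"
  "TensAr (fraction_cat C M \<mu>) = TensAr C" "UnitOb\<^bsub>fraction_cat C M \<mu>\<^esub> = UnitOb"
  by (simp_all add: fraction_cat_def)

lemma fraction_cat_hom:
  "f \<in> hom_set (fraction_cat C M \<mu>) X Y \<longleftrightarrow> f \<in> hom_set C X Y \<and> f \<in> fractions C M \<mu>"
  by (auto simp: hom_set_def fraction_cat_sel elim: fractionsE)

lemma fraction_cat_monoidal: "strict_monoidal_category (fraction_cat C M \<mu>)"
proof
  show "Src\<^bsub>fraction_cat C M \<mu>\<^esub> f \<in> Ob (fraction_cat C M \<mu>)"
    "Tgt\<^bsub>fraction_cat C M \<mu>\<^esub> f \<in> Ob (fraction_cat C M \<mu>)" if "f \<in> Ar (fraction_cat C M \<mu>)" for f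
    using that by (auto simp: fraction_cat_sel hom_set_def elim!: fractionsE)
  show "X \<odot>\<^bsub>fraction_cat C M \<mu>\<^esub> Y \<in> Ob (fraction_cat C M \<mu>)"
    if "X \<in> Ob (fraction_cat C M \<mu>)" "Y \<in> Ob (fraction_cat C M \<mu>)" for X Y
    using that by (auto simp: fraction_cat_sel simp flip: mpow_add)
  show "UnitOb\<^bsub>fraction_cat C M \<mu>\<^esub> \<in> Ob (fraction_cat C M \<mu>)"
    using rangeI[of mpow 0] by (simp add: fraction_cat_sel)
qed (auto simp: fraction_cat_sel fraction_cat_hom mpow_Ob Idn_hom Idn_fraction Cmp_Idn_left
    Cmp_Idn_right TensOb_assoc TensOb_unit_left TensOb_unit_right TensAr_unit_left
    TensAr_unit_right Tens_Idn TensAr_hom Tens_fraction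
    fractions_Ar intro: Cmp_hom Cmp_fraction Cmp_assoc Tens_Cmp TensAr_assoc)

lemma fraction_cat_idempotent: "idempotent_object (fraction_cat C M \<mu>) M \<mu>"
proof -
  obtain \<nu> where "\<nu> \<in> hom_set C M (M \<odot> M)" "\<nu> \<cdot> \<mu> = Idn (M \<odot> M)" "\<mu> \<cdot> \<nu> = Idn M"
    using \<mu>_iso by (rule iso_setE)
  then show ?thesis
    using iso_inverse_fraction[OF \<mu>_fraction] \<mu>_fraction \<mu>_hom rangeI[of mpow 1] mpow_1
    by (auto simp: idempotent_object_def iso_set_def fraction_cat_sel fraction_cat_hom)
qed

lemma fraction_cat_inclusion: "strict_monoidal_functor (fraction_cat C M \<mu>) C id id"
proof -
  interpret S: strict_monoidal_category "fraction_cat C M \<mu>" by (rule fraction_cat_monoidal)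
  show ?thesis
    by unfold_locales (auto simp: fraction_cat_sel fraction_cat_hom mpow_Ob)
qed

end

lemma (in strict_monoidal_functor) functor_obj_power:
  assumes "M \<in> Ob C"
  shows "Fo (obj_power C M n) = obj_power D (Fo M) n"
proof -
  have "obj_power C M n \<in> Ob C" for n
    by (induction n) (auto simp: assms C.TensOb_Ob C.UnitOb_Ob)
  then show ?thesis
    by (induction n) (auto simp: Fo_Unit Fo_Tens assms)
qed

lemma (in strict_monoidal_functor) functor_tree_map:
  assumes "idempotent_object C M \<mu>"
  shows "Fa (tree_map C M \<mu> t) = tree_map D (Fo M) (Fa \<mu>) t"
proof -
  interpret M: monoidal_idempotent C M \<mu> by unfold_locales (fact assms)
  show ?thesis
  proof (induction t)
    case (Node l r)
    then show ?case
      using Fa_Cmp[OF C.TensAr_hom[OF M.tree_hom M.tree_hom] M.\<mu>_hom, of l r]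
        Fa_Tens[OF M.tree_hom[THEN hom_setD(1)] M.tree_hom[THEN hom_setD(1)], of l r]
      by simp
  qed (simp add: Fa_Idn M.M_Ob)
qed

text \<open>
  The fractions form a monoidal subcategory, so the universal property provides a retraction of
  the free category onto it; by uniqueness this retraction is the identity.
\<close>

lemma free_all_fractions:
  fixes C :: "('o, 'm) moncat"
  assumes free: "freely_generated_by_idempotent TYPE('o + 'a) TYPE('m + 'b) C A \<alpha>"
    and inj: "inj (obj_power C A)" and f: "f \<in> Ar C"
  shows "f \<in> fractions C A \<alpha>"
proof -
  interpret monoidal_idempotent_inj C A \<alpha>
    using free inj
    by (auto simp: freely_generated_by_idempotent_def monoidal_idempotent_inj_def
        monoidal_idempotent_def monoidal_idempotent_axioms_def monoidal_idempotent_inj_axioms_def)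
  let ?S = "fraction_cat C A \<alpha>"
  have Inl: "inj_on (Inl :: 'o \<Rightarrow> 'o + 'a) X" "inj_on (Inl :: 'm \<Rightarrow> 'm + 'b) Y" for X Y
    by (auto simp: inj_on_def)
  obtain Go Ga where G: "strict_monoidal_functor C ?S Go Ga" "Go A = A" "Ga \<alpha> = \<alpha>"
    using free_functor_exists[OF free fraction_cat_monoidal Inl fraction_cat_idempotent] by blast
  interpret G: strict_monoidal_functor C ?S Go Ga by fact
  have "strict_monoidal_functor C C Go Ga"
    using strict_monoidal_functor_comp[OF G(1) fraction_cat_inclusion] by simp
  moreover have "strict_monoidal_functor C C id id"
    by unfold_locales auto
  ultimately have "Ga f = id f"
    by (rule free_functor_unique[OF free strict_monoidal_category_axioms Inl])
      (use G(2,3) f in auto)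
  then show ?thesis
    using G.Fa_hom[OF Ar_hom_set[OF f]] by (auto simp: fraction_cat_hom)
qed

section \<open>Maps between half-open intervals\<close>

text \<open>
  A map \<open>[0, m) \<rightarrow> [0, n)\<close> is represented by its extension to the real line which is the identity
  below \<open>0\<close> and a translation from \<open>m\<close> onwards.  With this choice composition is plain
  composition of functions, the unit laws of juxtaposition are equalities, and the extension of a
  map \<open>[0, 1) \<rightarrow> [0, 1)\<close> fixes \<open>1\<close>, as elements of Thompson's group do.  The intervals are half-open
  because juxtaposition must be functorial: with closed ones, a map could send a point of the left
  interval to the point where the right one begins.
\<close>

definition interval_map :: "nat \<Rightarrow> nat \<Rightarrow> (real \<Rightarrow> real) \<Rightarrow> bool" where
  "interval_map m n f \<longleftrightarrow>
     (\<forall>x<0. f x = x) \<and> (\<forall>x. 0 \<le> x \<and> x < real m \<longrightarrow> 0 \<le> f x \<and> f x < real n) \<and>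
     (\<forall>x\<ge>real m. f x = x - real m + real n)"

definition juxtapose :: "nat \<Rightarrow> nat \<Rightarrow> (real \<Rightarrow> real) \<Rightarrow> (real \<Rightarrow> real) \<Rightarrow> real \<Rightarrow> real" where
  "juxtapose m n f g = (\<lambda>x. if x < m then f x else g (x - m) + n)"

definition interval_cat :: "(nat, nat \<times> nat \<times> (real \<Rightarrow> real)) moncat" where
  "interval_cat = moncat.make UNIV {(m, n, f). interval_map m n f} fst (fst \<circ> snd)
     (\<lambda>n. (n, n, id)) (\<lambda>(_, k, g) (m, _, f). (m, k, g \<circ> f))
     (+) (\<lambda>(m, n, f) (m', n', g). (m + m', n + n', juxtapose m n f g)) 0"

lemma interval_cat_sel:
  "Ob interval_cat = UNIV" "Ar interval_cat = {(m, n, f). interval_map m n f}"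
  "Src\<^bsub>interval_cat\<^esub> = fst" "Tgt\<^bsub>interval_cat\<^esub> = fst \<circ> snd"
  "Idn\<^bsub>interval_cat\<^esub> n = (n, n, id)"
  "Cmp interval_cat (n', k, g) (m, n, f) = (m, k, g \<circ> f)"
  "TensOb interval_cat = (+)"
  "TensAr interval_cat (m, n, f) (m', n', g') = (m + m', n + n', juxtapose m n f g')"
  "UnitOb\<^bsub>interval_cat\<^esub> = 0"
  by (simp_all add: interval_cat_def moncat.defs)

lemma interval_cat_hom:
  "a \<in> hom_set interval_cat m n \<longleftrightarrow> (\<exists>f. a = (m, n, f) \<and> interval_map m n f)"
  by (cases a) (auto simp: hom_set_def interval_cat_sel)

lemma interval_mapD:
  assumes "interval_map m n f"
  shows "x < 0 \<Longrightarrow> f x = x" "\<lbrakk>0 \<le> x; x < real m\<rbrakk> \<Longrightarrow> 0 \<le> f x"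
    "\<lbrakk>0 \<le> x; x < real m\<rbrakk> \<Longrightarrow> f x < real n" "real m \<le> x \<Longrightarrow> f x = x - real m + real n"
    "f (real m) = real n"
  using assms by (auto simp: interval_map_def)

lemma interval_map_less: "\<lbrakk>interval_map m n f; x < real m\<rbrakk> \<Longrightarrow> f x < real n"
  by (cases "x < 0") (auto simp: interval_map_def)

lemma interval_map_nonneg: "\<lbrakk>interval_map m n f; 0 \<le> x\<rbrakk> \<Longrightarrow> 0 \<le> f x"
  by (cases "x < real m") (auto simp: interval_map_def)

lemma interval_map_id: "interval_map n n id"
  by (simp add: interval_map_def)

lemma interval_map_comp:
  "\<lbrakk>interval_map m n f; interval_map n k g\<rbrakk> \<Longrightarrow> interval_map m k (g \<circ> f)"
  by (auto simp: interval_map_def)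

lemma interval_map_juxtapose:
  "\<lbrakk>interval_map m n f; interval_map m' n' g\<rbrakk> \<Longrightarrow>
    interval_map (m + m') (n + n') (juxtapose m n f g)"
  by (auto simp: interval_map_def juxtapose_def add_strict_increasing intro: add_strict_increasing2)

lemma juxtapose_comp:
  assumes "interval_map m n f" "interval_map m' n' f'"
  shows "juxtapose m k (g \<circ> f) (g' \<circ> f') = juxtapose n k g g' \<circ> juxtapose m n f f'"
proof
  fix x
  show "juxtapose m k (g \<circ> f) (g' \<circ> f') x = (juxtapose n k g g' \<circ> juxtapose m n f f') x"
    using interval_map_less[OF assms(1), of x] interval_map_nonneg[OF assms(2), of "x - m"]
    by (cases "x < m") (simp_all add: juxtapose_def)
qed

lemma juxtapose_assoc:
  "juxtapose (m + m') (n + n') (juxtapose m n f g) h = juxtapose m n f (juxtapose m' n' g h)"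
  by (auto simp: juxtapose_def algebra_simps)

lemma juxtapose_id: "juxtapose n n id id = id"
  by (auto simp: juxtapose_def)

lemma juxtapose_unit_left: "interval_map m n f \<Longrightarrow> juxtapose 0 0 id f = f"
  by (auto simp: juxtapose_def interval_map_def)

lemma juxtapose_unit_right: "interval_map m n f \<Longrightarrow> juxtapose m n f id = f"
  by (auto simp: juxtapose_def interval_map_def)

lemma interval_cat_monoidal: "strict_monoidal_category interval_cat"
  by unfold_locales
    (auto simp: interval_cat_sel interval_cat_hom interval_map_id interval_map_comp
      interval_map_juxtapose juxtapose_comp juxtapose_assoc juxtapose_id juxtapose_unit_left
      juxtapose_unit_right comp_assoc)

text \<open>
  The object \<open>1\<close> has to keep its form: the interpretation below is about \<open>1\<close>, and its facts would
  not match goals in which it has been rewritten to \<open>Suc 0\<close>.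
\<close>

declare One_nat_def [simp del]

text \<open>
  Outside \<open>[0, 2)\<close> and \<open>[0, 1)\<close> the values are those of the extension to the real line.
\<close>

definition halve :: "real \<Rightarrow> real" where
  "halve x = (if x < 0 then x else if x < 2 then x / 2 else x - 1)"

definition double :: "real \<Rightarrow> real" where
  "double x = (if x < 0 then x else if x < 1 then 2 * x else x + 1)"

lemma interval_map_halve: "interval_map 2 1 halve"
  by (auto simp: interval_map_def halve_def)

lemma interval_map_double: "interval_map 1 2 double"
  by (auto simp: interval_map_def double_def)

lemma halve_double: "halve \<circ> double = id" "double \<circ> halve = id"
  by (auto simp: halve_def double_def fun_eq_iff)

lemma interval_cat_idempotent: "idempotent_object interval_cat 1 (2, 1, halve)"
proof -
  have "(2, 1, halve) \<in> hom_set interval_cat 2 1" "(1, 2, double) \<in> hom_set interval_cat 1 2"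
    by (simp_all add: interval_cat_hom interval_map_halve interval_map_double)
  then show ?thesis
    unfolding idempotent_object_def iso_set_def
    by (auto simp: interval_cat_sel halve_double one_add_one intro!: bexI[of _ "(1, 2, double)"])
qed

lemma obj_power_interval_cat: "obj_power interval_cat 1 n = n"
  by (induction n) (auto simp: interval_cat_sel)

interpretation PL: monoidal_idempotent_inj interval_cat 1 "(2, 1, halve)"
  using interval_cat_monoidal interval_cat_idempotent
  by (simp add: monoidal_idempotent_inj_def monoidal_idempotent_def
      monoidal_idempotent_axioms_def monoidal_idempotent_inj_axioms_def inj_def
      obj_power_interval_cat)


section \<open>The interval map of a tree\<close>

primrec tree_fun :: "btree \<Rightarrow> real \<Rightarrow> real" where
  "tree_fun Leaf = id"
| "tree_fun (Node l r) = halve \<circ> juxtapose (leaves l) 1 (tree_fun l) (tree_fun r)"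

lemma tree_map_interval_cat:
  "tree_map interval_cat 1 (2, 1, halve) t = (leaves t, 1, tree_fun t)"
  by (induction t) (auto simp: interval_cat_sel)

lemma interval_map_tree_fun: "interval_map (leaves t) 1 (tree_fun t)"
  using PL.tree_hom[of t]
  by (simp add: tree_map_interval_cat obj_power_interval_cat interval_cat_hom)

lemma tree_fun_inverse:
  obtains g where "interval_map 1 (leaves t) g" "tree_fun t \<circ> g = id" "g \<circ> tree_fun t = id"
  using PL.tree_iso[of t]
  by (auto simp: tree_map_interval_cat obj_power_interval_cat iso_set_def interval_cat_hom
      interval_cat_sel)

lemma tree_fun_leaves: "tree_fun t (leaves t) = 1"
  using interval_mapD(5)[OF interval_map_tree_fun] by simp

lemma tree_fun_less_1: "x < real (leaves t) \<Longrightarrow> tree_fun t x < 1"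
  using interval_map_less[OF interval_map_tree_fun] by simp

lemma tree_fun_bounds:
  assumes "0 \<le> x" "x \<le> real (leaves t)"
  shows "0 \<le> tree_fun t x" "tree_fun t x \<le> 1"
  using interval_map_nonneg[OF interval_map_tree_fun assms(1)] tree_fun_less_1[of x t]
    tree_fun_leaves[of t] assms(2) by (auto simp: order_le_less)

lemma tree_fun_0: "tree_fun t 0 = 0"
  by (induction t) (auto simp: juxtapose_def halve_def leaves_pos)

text \<open>
  The closed intervals in this lemma and the next overlap in the point \<open>leaves l\<close>, where both
  formulas give \<open>1/2\<close>.
\<close>

lemma tree_fun_Node_left:
  assumes "0 \<le> x" "x \<le> real (leaves l)"
  shows "tree_fun (Node l r) x = tree_fun l x / 2"
  using tree_fun_bounds[OF assms] tree_fun_leaves[of l] assms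
  by (auto simp: juxtapose_def halve_def tree_fun_0)

lemma tree_fun_Node_right:
  assumes "0 \<le> x" "x \<le> real (leaves r)"
  shows "tree_fun (Node l r) (real (leaves l) + x) = (1 + tree_fun r x) / 2"
  using tree_fun_bounds[OF assms] assms
  by (auto simp: juxtapose_def halve_def field_simps)

text \<open>
  The first subtree has as many leaves as there are unit intervals sent below \<open>1/2\<close>, so the map of a
  tree determines where to split it; undoing the halving leaves the maps of the subtrees.
\<close>

lemma tree_fun_eqD: "\<lbrakk>leaves t = leaves u; tree_fun t = tree_fun u\<rbrakk> \<Longrightarrow> t = u"
proof (induction t arbitrary: u)
  case Leaf
  then show ?case using leaves_eq_1[of u] by simp
next
  case (Node l r)
  have "leaves (Node l r) \<noteq> 1" using leaves_eq_1[of "Node l r"] by blast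
  then obtain l' r' where u: "u = Node l' r'"
    using Node.prems(1) by (cases u) auto
  have "double \<circ> (halve \<circ> f) = f" for f :: "real \<Rightarrow> real"
    using halve_double(2) by (metis comp_assoc id_comp)
  then have eq: "juxtapose (leaves l) 1 (tree_fun l) (tree_fun r) =
      juxtapose (leaves l') 1 (tree_fun l') (tree_fun r')"
    using Node.prems(2) u by (metis tree_fun.simps(2))
  have below: "juxtapose (leaves l) 1 (tree_fun l) (tree_fun r) x < 1 \<longleftrightarrow> x < real (leaves l)" for x l r
    using tree_fun_less_1[of x l] interval_map_nonneg[OF interval_map_tree_fun, of "x - real (leaves l)" r]
    by (auto simp: juxtapose_def)
  have l: "leaves l = leaves l'"
    using below[of l r "leaves l"] below[of l r "leaves l'"] below[of l' r' "leaves l"]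
      below[of l' r' "leaves l'"] eq by simp
  then have r: "leaves r = leaves r'" using Node.prems(1) u by simp
  have "tree_fun l x = tree_fun l' x" for x
  proof (cases "x < real (leaves l)")
    case True
    then show ?thesis using fun_cong[OF eq, of x] l by (simp add: juxtapose_def)
  next
    case False
    then show ?thesis using interval_mapD(4)[OF interval_map_tree_fun] l by simp
  qed
  moreover have "tree_fun r x = tree_fun r' x" for x
  proof (cases "x < 0")
    case True
    then show ?thesis using interval_mapD(1)[OF interval_map_tree_fun] by simp
  next
    case False
    then show ?thesis using fun_cong[OF eq, of "x + leaves l"] l by (simp add: juxtapose_def)
  qed
  ultimately show ?case using Node.IH l r u by (auto simp: fun_eq_iff)
qed

lemma tree_fun_linear:
  "i < leaves t \<Longrightarrow> \<exists>k :: nat. \<forall>x \<in> {real i..real (Suc i)}. tree_fun t x = tree_fun t i + (x - real i) / 2 ^ k"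
proof (induction t arbitrary: i)
  case Leaf
  then show ?case by (auto intro!: exI[of _ 0])
next
  case (Node l r)
  show ?case
  proof (cases "i < leaves l")
    case True
    obtain k :: nat where k: "\<And>x. x \<in> {real i..real (Suc i)} \<Longrightarrow> tree_fun l x = tree_fun l i + (x - real i) / 2 ^ k"
      using Node.IH(1)[OF True] by blast
    have "tree_fun (Node l r) x = tree_fun (Node l r) i + (x - real i) / 2 ^ Suc k"
      if x: "x \<in> {real i..real (Suc i)}" for x
      using k[OF x] x True tree_fun_Node_left[of x l r] tree_fun_Node_left[of i l r]
      by (simp del: tree_fun.simps add: add_divide_distrib)
    then show ?thesis by blast
  next
    case False
    define j where "j = i - leaves l"
    have i: "i = leaves l + j" and j: "j < leaves r" using False Node.prems by (auto simp: j_def)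
    obtain k :: nat where k: "\<And>x. x \<in> {real j..real (Suc j)} \<Longrightarrow> tree_fun r x = tree_fun r j + (x - real j) / 2 ^ k"
      using Node.IH(2)[OF j] by blast
    have "tree_fun (Node l r) x = tree_fun (Node l r) i + (x - real i) / 2 ^ Suc k"
      if x: "x \<in> {real i..real (Suc i)}" for x
      using k[of "x - real (leaves l)"] x i j tree_fun_Node_right[of "x - real (leaves l)" r l]
        tree_fun_Node_right[of j r l]
      by (simp del: tree_fun.simps add: add_divide_distrib diff_diff_eq)
    then show ?thesis by blast
  qed
qed

text \<open>
  On a unit interval the map of a tree is determined by its values at the two ends.
\<close>

lemma tree_fun_interpolate:
  assumes "i < leaves t" "x \<in> {real i..real (Suc i)}"
  shows "tree_fun t x = tree_fun t i + (tree_fun t (Suc i) - tree_fun t i) * (x - real i)"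
proof -
  obtain k :: nat where k: "\<And>x. x \<in> {real i..real (Suc i)} \<Longrightarrow> tree_fun t x = tree_fun t i + (x - real i) / 2 ^ k"
    using tree_fun_linear[OF assms(1)] by blast
  from k[of "Suc i"] have "tree_fun t (Suc i) - tree_fun t i = 1 / 2 ^ k" by simp
  then show ?thesis using k[OF assms(2)] by simp
qed

lemma tree_fun_dyadic: "i \<le> leaves t \<Longrightarrow> tree_fun t i \<in> dyadic_rationals"
proof (induction t arbitrary: i)
  case Leaf
  show ?case
    by (auto simp: dyadic_rationals_def intro!: exI[of _ "int i"] exI[of _ "0 :: nat"])
next
  case (Node l r)
  have half: "x / 2 \<in> dyadic_rationals" "(1 + x) / 2 \<in> dyadic_rationals"
    if "x \<in> dyadic_rationals" for x
  proof -
    from that obtain m :: int and k :: nat where x: "x = m / 2 ^ k"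
      by (auto simp: dyadic_rationals_def)
    then have "x / 2 = of_int m / 2 ^ Suc k" "(1 + x) / 2 = of_int (2 ^ k + m) / 2 ^ Suc k"
      by (simp_all add: field_simps)
    then show "x / 2 \<in> dyadic_rationals" "(1 + x) / 2 \<in> dyadic_rationals"
      unfolding dyadic_rationals_def by blast+
  qed
  show ?case
  proof (cases "i \<le> leaves l")
    case True
    then have "tree_fun (Node l r) i = tree_fun l i / 2"
      by (intro tree_fun_Node_left) auto
    then show ?thesis using half(1)[OF Node.IH(1)[OF True]] by (simp only:)
  next
    case False
    define j where "j = i - leaves l"
    have i: "real i = leaves l + real j" and j: "j \<le> leaves r"
      using False Node.prems by (auto simp: j_def)
    then have "tree_fun (Node l r) i = (1 + tree_fun r j) / 2"
      using tree_fun_Node_right[of j r l] by (simp only: of_nat_0_le_iff of_nat_le_iff)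
    then show ?thesis using half(2)[OF Node.IH(2)[OF j]] by (simp only:)
  qed
qed

section \<open>Dyadic subdivisions and elements of Thompson's group\<close>

text \<open>
  The standard dyadic intervals within \<open>[0, \<infinity>)\<close> of length at most \<open>1\<close>; those within \<open>[0, 1]\<close> are
  the intervals that arise from \<open>[0, 1]\<close> by repeated halving.
\<close>

definition dyadic_interval :: "real \<Rightarrow> real \<Rightarrow> bool" where
  "dyadic_interval a b \<longleftrightarrow> (\<exists>(i :: nat) (d :: nat). a = i / 2 ^ d \<and> b = Suc i / 2 ^ d)"

lemma chain_less:
  fixes s :: "nat \<Rightarrow> real"
  assumes "\<And>i. i < n \<Longrightarrow> s i < s (Suc i)"
  shows "\<lbrakk>i < j; j \<le> n\<rbrakk> \<Longrightarrow> s i < s j"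
proof (induction j)
  case (Suc j)
  then show ?case using assms[of j] by (cases "i = j") auto
qed simp

lemma chain_locate:
  fixes s :: "nat \<Rightarrow> real"
  assumes "s 0 \<le> x" "x < s n"
  obtains i where "i < n" "s i \<le> x" "x < s (Suc i)"
proof -
  have "\<exists>i<n. s i \<le> x \<and> x < s (Suc i)"
    using assms(2)
  proof (induction n)
    case 0
    then show ?case using assms(1) by simp
  next
    case (Suc n)
    then show ?case by (cases "x < s n") (auto simp: less_Suc_eq)
  qed
  then show thesis using that by blast
qed

lemma dyadic_interval_less: "dyadic_interval a b \<Longrightarrow> a < b"
  by (auto simp: dyadic_interval_def divide_strict_right_mono)

text \<open>
  Standard dyadic intervals are nested or have disjoint interiors, so only \<open>[0, 1]\<close> itself contains
  \<open>1/2\<close> in its interior.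
\<close>

lemma dyadic_interval_midpoint:
  assumes "dyadic_interval a b" "b \<le> 1" "a < 1 / 2" "1 / 2 < b"
  shows "a = 0 \<and> b = 1"
proof -
  obtain i d :: nat where ab: "a = i / 2 ^ d" "b = Suc i / 2 ^ d"
    using assms(1) by (auto simp: dyadic_interval_def)
  show ?thesis
  proof (cases d)
    case 0
    then show ?thesis using ab assms(2) by simp
  next
    case (Suc e)
    have "i / 2 ^ Suc e < 1 / 2" "1 / 2 < Suc i / 2 ^ Suc e"
      using ab assms(3,4) Suc by simp_all
    then have "real i < real (2 ^ e)" "real (2 ^ e) < real (Suc i)"
      by (simp_all add: field_simps)
    then have "i < 2 ^ e" "2 ^ e < Suc i"
      unfolding of_nat_less_iff .
    then show ?thesis by simp
  qed
qed

lemma dyadic_interval_double_left: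
  assumes "dyadic_interval a b" "b \<le> 1 / 2"
  shows "dyadic_interval (2 * a) (2 * b)"
proof -
  obtain i d :: nat where ab: "a = i / 2 ^ d" "b = Suc i / 2 ^ d"
    using assms(1) by (auto simp: dyadic_interval_def)
  then have "d \<noteq> 0" using assms(2) by (cases d) auto
  then obtain e where "d = Suc e" by (cases d) auto
  then have "2 * a = i / 2 ^ e" "2 * b = Suc i / 2 ^ e" using ab by (simp_all add: field_simps)
  then show ?thesis unfolding dyadic_interval_def by blast
qed

lemma dyadic_interval_double_right:
  assumes "dyadic_interval a b" "1 / 2 \<le> a" "b \<le> 1"
  shows "dyadic_interval (2 * a - 1) (2 * b - 1)"
proof -
  obtain i d :: nat where ab: "a = i / 2 ^ d" "b = Suc i / 2 ^ d"
    using assms(1) by (auto simp: dyadic_interval_def)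
  then have "d \<noteq> 0" using assms(2,3) by (cases d) auto
  then obtain e where e: "d = Suc e" by (cases d) auto
  have "1 / 2 \<le> i / 2 ^ Suc e" using ab assms(2) e by simp
  then have "real (2 ^ e) \<le> real i" by (simp add: field_simps)
  then have "2 ^ e \<le> i" unfolding of_nat_le_iff .
  then have "real (i - 2 ^ e) = real i - 2 ^ e" by (simp add: of_nat_diff)
  then have "2 * a - 1 = (i - 2 ^ e) / 2 ^ e" "2 * b - 1 = Suc (i - 2 ^ e) / 2 ^ e"
    using ab e by (simp_all add: field_simps)
  then show ?thesis unfolding dyadic_interval_def by blast
qed

text \<open>
  If there is more than one piece, no piece has \<open>1/2\<close> in its interior, so \<open>1/2\<close> is a division point.
  The two halves, scaled to \<open>[0, 1]\<close>, are again subdivisions into standard dyadic intervals, with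
  fewer pieces, and give the two subtrees.
\<close>

lemma dyadic_partition_tree:
  assumes "0 < n" "s 0 = 0" "s n = 1" "\<And>i. i < n \<Longrightarrow> dyadic_interval (s i) (s (Suc i))"
  shows "\<exists>t. leaves t = n \<and> (\<forall>i\<le>n. tree_fun t i = s i)"
  using assms
proof (induction n arbitrary: s rule: less_induct)
  case (less n)
  show ?case
  proof (cases "n = 1")
    case True
    then have "tree_fun Leaf (real i) = s i" if "i \<le> n" for i
      using less.prems(2,3) that by (cases i) (auto simp: One_nat_def)
    then show ?thesis using True by (intro exI[of _ Leaf]) auto
  next
    case False
    have mono: "s i < s j" if "i < j" "j \<le> n" for i j
      using that chain_less[of n s] dyadic_interval_less[OF less.prems(4)] by blast
    have "\<exists>p. 1 / 2 \<le> s p" using less.prems(3) by (intro exI[of _ n]) simp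
    \<comment> \<open>The index of the division point \<open>1/2\<close>.\<close>
    define p where "p = (LEAST p. 1 / 2 \<le> s p)"
    have p: "1 / 2 \<le> s p" unfolding p_def using \<open>\<exists>p. _\<close> by (rule LeastI_ex)
    have "p \<le> n" unfolding p_def by (rule Least_le) (simp add: less.prems(3))
    have "p \<noteq> 0" using p less.prems(2) by (intro notI) simp
    then obtain q where q: "p = Suc q" by (cases p) auto
    have "s q < 1 / 2"
      using not_less_Least[of q "\<lambda>p. 1 / 2 \<le> s p"] q unfolding p_def by simp
    have "q < n" using q \<open>p \<le> n\<close> by simp
    have le1: "s i \<le> 1" if "i \<le> n" for i
      using mono[of i n] that less.prems(3) by (cases "i = n") auto
    have half: "s p = 1 / 2"
    proof (rule ccontr)
      assume "s p \<noteq> 1 / 2"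
      then have "s q = 0 \<and> s p = 1"
        using p \<open>s q < 1 / 2\<close> less.prems(4)[OF \<open>q < n\<close>] le1[OF \<open>p \<le> n\<close>] q
        by (intro dyadic_interval_midpoint) auto
      then have "q = 0" "p = n"
        using mono[of 0 q] mono[of p n] less.prems(2,3) \<open>q < n\<close> \<open>p \<le> n\<close>
        by (metis gr0I less_irrefl less_imp_le, metis le_neq_implies_less less_irrefl order_refl)
      then show False using False q by simp
    qed
    have "p < n" using \<open>p \<le> n\<close> half less.prems(3) by (cases "p = n") auto
    have le_half: "s i \<le> 1 / 2" if "i \<le> p" for i
      using mono[of i p] half that \<open>p \<le> n\<close> by (cases "i = p") auto
    have ge_half: "1 / 2 \<le> s i" if "p \<le> i" "i \<le> n" for i
      using mono[of p i] half that by (cases "i = p") auto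
    have "\<exists>l. leaves l = p \<and> (\<forall>i\<le>p. tree_fun l i = 2 * s i)"
    proof (rule less.IH)
      show "dyadic_interval (2 * s i) (2 * s (Suc i))" if "i < p" for i
        using that \<open>p \<le> n\<close> by (intro dyadic_interval_double_left less.prems(4) le_half) auto
    qed (use \<open>p < n\<close> \<open>p \<noteq> 0\<close> half less.prems(2) in auto)
    then obtain l where l: "leaves l = p" "\<And>i. i \<le> p \<Longrightarrow> tree_fun l i = 2 * s i" by blast
    have "\<exists>r. leaves r = n - p \<and> (\<forall>i\<le>n - p. tree_fun r i = 2 * s (p + i) - 1)"
    proof (rule less.IH)
      show "dyadic_interval (2 * s (p + i) - 1) (2 * s (p + Suc i) - 1)" if "i < n - p" for i
        using that dyadic_interval_double_right[OF less.prems(4)[of "p + i"]]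
          ge_half[of "p + i"] le1[of "Suc (p + i)"] by auto
    qed (use \<open>p < n\<close> \<open>p \<noteq> 0\<close> half less.prems(3) in auto)
    then obtain r where r: "leaves r = n - p"
      "\<And>i. i \<le> n - p \<Longrightarrow> tree_fun r i = 2 * s (p + i) - 1" by blast
    have "tree_fun (Node l r) i = s i" if i: "i \<le> n" for i
    proof (cases "i \<le> p")
      case True
      then have "tree_fun (Node l r) i = tree_fun l i / 2"
        using l(1) by (intro tree_fun_Node_left) auto
      then show ?thesis using l(2)[OF True] by (simp del: tree_fun.simps)
    next
      case False
      then obtain k where k: "i = p + k" "k \<le> n - p" using i le_Suc_ex[of p i] by auto
      then have "tree_fun (Node l r) i = (1 + tree_fun r k) / 2"
        using tree_fun_Node_right[of k r l] l(1) r(1) by (simp del: tree_fun.simps)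
      then show ?thesis using r(2)[OF k(2)] k(1) by (simp del: tree_fun.simps)
    qed
    then show ?thesis
      using l(1) r(1) \<open>p < n\<close> by (intro exI[of _ "Node l r"]) (auto simp del: tree_fun.simps)
  qed
qed

lemma thompson_F_carrier:
  "f \<in> carrier thompson_F \<longleftrightarrow> f \<in> Bij {0..1} \<and> dyadic_piecewise_linear f"
  by (simp add: thompson_F_def)

lemma thompson_F_mult:
  "\<lbrakk>g \<in> carrier thompson_F; f \<in> carrier thompson_F\<rbrakk> \<Longrightarrow>
    g \<otimes>\<^bsub>thompson_F\<^esub> f = compose {0..1} g f"
  by (simp add: thompson_F_def BijGroup_def)

lemma interval_map_unit:
  assumes "interval_map 1 1 h" "x \<in> {0..1}"
  shows "h x \<in> {0..1}"
  using interval_mapD(2,3)[OF assms(1), of x] interval_mapD(5)[OF assms(1)] assms(2)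
  by (cases "x = 1") (auto simp: order_le_less)

text \<open>
  The breakpoints are those of the subdivision of \<open>t\<close>.  On each piece the map is the inverse of an
  affine map of slope \<open>2\<^sup>-\<^sup>d\<close> followed by one of slope \<open>2\<^sup>-\<^sup>e\<close>.
\<close>

lemma tree_pair_thompson:
  assumes h: "interval_map 1 1 h" and k: "interval_map 1 1 k" "h \<circ> k = id" "k \<circ> h = id"
    and leaves: "leaves t = leaves u" and tu: "h \<circ> tree_fun t = tree_fun u"
  shows "restrict h {0..1} \<in> carrier thompson_F"
proof -
  have hk: "h (k x) = x" "k (h x) = x" for x
    using k(2,3) by (simp_all add: pointfree_idE)
  have "bij_betw h {0..1} {0..1}"
    by (rule bij_betw_byWitness[of _ k])
      (use hk interval_map_unit[OF h] interval_map_unit[OF k(1)] in auto)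
  then have "restrict h {0..1} \<in> Bij {0..1}"
    by (simp add: Bij_def)
  moreover have "dyadic_piecewise_linear (restrict h {0..1})"
    unfolding dyadic_piecewise_linear_def
  proof (rule exI[of _ "leaves t"], rule exI[of _ "\<lambda>i. tree_fun t (real i)"],
      intro conjI allI impI)
    let ?n = "leaves t" and ?t = "\<lambda>i. tree_fun t (real i)"
    have hu: "h (tree_fun t x) = tree_fun u x" for x
      using tu by (metis comp_apply)
    have unit: "?t i \<in> {0..1}" if "i \<le> ?n" for i
      using tree_fun_bounds[of "real i" t] that by simp
    show "?t 0 = 0" by (simp add: tree_fun_0)
    show "?t ?n = 1" by (rule tree_fun_leaves)
    fix i
    show "?t i < ?t (Suc i)" if i: "i < ?n"
    proof -
      obtain d :: nat where d:
        "\<And>x. x \<in> {real i..real (Suc i)} \<Longrightarrow> tree_fun t x = ?t i + (x - real i) / 2 ^ d"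
        using tree_fun_linear[OF i] by blast
      show ?thesis using d[of "real (Suc i)"] by simp
    qed
    show "?t i \<in> dyadic_rationals" if "i \<le> ?n"
      using tree_fun_dyadic[OF that] .
    show "restrict h {0..1} (?t i) \<in> dyadic_rationals" if "i \<le> ?n"
      using tree_fun_dyadic[of i u] unit[OF that] that leaves hu by simp
    assume i: "i < ?n"
    obtain d :: nat where d:
      "\<And>x. x \<in> {real i..real (Suc i)} \<Longrightarrow> tree_fun t x = ?t i + (x - real i) / 2 ^ d"
      using tree_fun_linear[OF i] by blast
    have "i < leaves u" using i leaves by simp
    from tree_fun_linear[OF this] obtain e :: nat where e:
      "\<And>x. x \<in> {real i..real (Suc i)} \<Longrightarrow> tree_fun u x = tree_fun u i + (x - real i) / 2 ^ e"
      by blast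
    have "restrict h {0..1} x = restrict h {0..1} (?t i) + 2 powi (int d - int e) * (x - ?t i)"
      if x: "x \<in> {?t i..?t (Suc i)}" for x
    proof -
      \<comment> \<open>The preimage of \<open>x\<close> under the affine map by which \<open>t\<close> acts on its \<open>i\<close>-th unit interval.\<close>
      define y where "y = real i + 2 ^ d * (x - ?t i)"
      have "?t (Suc i) = ?t i + (real (Suc i) - real i) / 2 ^ d"
        by (rule d) simp
      then have "x - ?t i \<le> 1 / 2 ^ d"
        using x by simp
      then have "2 ^ d * (x - ?t i) \<le> 1"
        by (simp add: field_simps)
      then have y: "y \<in> {real i..real (Suc i)}" using x by (simp add: y_def)
      have "x = tree_fun t y" using d[OF y] by (simp add: y_def)
      moreover have "x \<in> {0..1}"
        using x unit[of i] unit[of "Suc i"] i by auto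
      ultimately have "restrict h {0..1} x = tree_fun u y" using hu by simp
      also have "\<dots> = tree_fun u i + 2 ^ d / 2 ^ e * (x - ?t i)"
        using e[OF y] by (simp add: y_def)
      finally show ?thesis
        using hu unit[of i] i by (simp add: power_int_diff)
    qed
    then show "\<exists>k :: int. \<forall>x \<in> {?t i..?t (Suc i)}.
        restrict h {0..1} x = restrict h {0..1} (?t i) + 2 powi k * (x - ?t i)"
      by blast
  qed
  ultimately show ?thesis by (simp add: thompson_F_carrier)
qed

text \<open>
  The exponent is shifted by \<open>k\<close> because the image of an interval of length \<open>2\<^sup>-\<^sup>N\<close> under a map of
  slope \<open>2\<^sup>k\<close> has length \<open>2\<^sup>k\<^sup>-\<^sup>N\<close>, and its ends are to be multiples of this length.
\<close>

lemma dyadic_eventually_Ints: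
  assumes "a \<in> dyadic_rationals"
  shows "\<forall>\<^sub>F N in sequentially. a * 2 ^ nat (int N - k) \<in> \<int>"
proof -
  obtain m :: int and d :: nat where a: "a = m / 2 ^ d"
    using assms by (auto simp: dyadic_rationals_def)
  show ?thesis
  proof (rule eventually_sequentiallyI[of "d + nat k"])
    fix N assume "d + nat k \<le> N"
    then have "d \<le> nat (int N - k)" by linarith
    then obtain e where "nat (int N - k) = d + e"
      using le_Suc_ex by blast
    then have "a * 2 ^ nat (int N - k) = of_int (m * 2 ^ e)"
      by (simp add: a power_add)
    then show "a * 2 ^ nat (int N - k) \<in> \<int>" by (metis Ints_of_int)
  qed
qed

text \<open>
  Divide \<open>[0, 1]\<close> regularly into \<open>2\<^sup>N\<close> pieces.  For large \<open>N\<close> all breakpoints of \<open>f\<close> are division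
  points and the image of each piece is a standard dyadic interval.  The trees \<open>t\<close> and \<open>u\<close> are those
  of the regular subdivision and of its image.
\<close>

lemma thompson_tree_pair:
  assumes f: "f \<in> carrier thompson_F"
  obtains t u where "leaves t = leaves u"
    "\<And>x. x \<in> {0..real (leaves t)} \<Longrightarrow> f (tree_fun t x) = tree_fun u x"
proof -
  obtain n b k where b: "b 0 = 0" "b n = 1" "\<And>i. i < n \<Longrightarrow> b i < b (Suc i)"
    and dyad: "\<And>i. i \<le> n \<Longrightarrow> b i \<in> dyadic_rationals" "\<And>i. i \<le> n \<Longrightarrow> f (b i) \<in> dyadic_rationals"
    and lin: "\<And>i x. \<lbrakk>i < n; x \<in> {b i..b (Suc i)}\<rbrakk> \<Longrightarrow> f x = f (b i) + 2 powi k i * (x - b i)"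
    using f unfolding thompson_F_carrier dyadic_piecewise_linear_def by metis
  have bij: "bij_betw f {0..1} {0..1}"
    using f by (simp add: thompson_F_carrier Bij_def)
  then have unit: "f x \<in> {0..1}" if "x \<in> {0..1}" for x
    using that by (auto simp: bij_betw_def)
  have f_less: "f (b i) < f (b (Suc i))" if "i < n" for i
    using lin[OF that, of "b (Suc i)"] b(3)[OF that] by simp
  have f_less': "f (b i) < f (b j)" if "i < j" "j \<le> n" for i j
    using chain_less[of n "\<lambda>i. f (b i)", OF f_less] that by blast
  \<comment> \<open>Being onto and, as all slopes are positive, increasing, \<open>f\<close> fixes \<open>0\<close> and \<open>1\<close>.\<close>
  have f_bounds: "f 0 \<le> f x \<and> f x \<le> f 1" if x: "x \<in> {0..1}" for x
  proof (cases "x = 1")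
    case True
    then show ?thesis using f_less'[of 0 n] b(1,2) by (cases n) auto
  next
    case False
    then obtain i where i: "i < n" "b i \<le> x" "x < b (Suc i)"
      using chain_locate[of b x n] x b(1,2) by auto
    have "f (b i) \<le> f x" using lin[of i x] i by simp
    moreover have "f x \<le> f (b (Suc i))"
      using lin[of i x] lin[of i "b (Suc i)"] i by simp
    moreover have "f (b 0) \<le> f (b i)" using f_less'[of 0 i] i(1) by (cases "i = 0") auto
    moreover have "f (b (Suc i)) \<le> f (b n)" using f_less'[of "Suc i" n] i(1) by (cases "Suc i = n") auto
    ultimately show ?thesis using b(1,2) by simp
  qed
  have "0 \<in> f ` {0..1}" "1 \<in> f ` {0..1}" using bij by (simp_all add: bij_betw_def)
  then have f01: "f 0 = 0" "f 1 = 1"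
    using f_bounds unit[of 0] unit[of 1] by fastforce+
  have "\<forall>\<^sub>F N in sequentially. \<forall>i \<in> {..n}. b i * 2 ^ nat (int N - 0) \<in> \<int>"
    by (intro eventually_ball_finite ballI dyadic_eventually_Ints dyad) auto
  moreover have "\<forall>\<^sub>F N in sequentially. \<forall>i \<in> {..<n}. f (b i) * 2 ^ nat (int N - k i) \<in> \<int>"
    by (intro eventually_ball_finite ballI dyadic_eventually_Ints dyad) auto
  moreover have "\<forall>\<^sub>F N in sequentially. k i \<le> int N" for i
    by (rule eventually_sequentiallyI[of "nat (k i)"]) linarith
  then have "\<forall>\<^sub>F N in sequentially. \<forall>i \<in> {..<n}. k i \<le> int N"
    by (intro eventually_ball_finite ballI) auto
  ultimately have "\<forall>\<^sub>F N in sequentially. (\<forall>i \<in> {..n}. b i * 2 ^ nat (int N - 0) \<in> \<int>) \<and>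
    (\<forall>i \<in> {..<n}. f (b i) * 2 ^ nat (int N - k i) \<in> \<int>) \<and> (\<forall>i \<in> {..<n}. k i \<le> int N)"
    by (intro eventually_conj)
  then obtain N where N: "\<And>i. i \<le> n \<Longrightarrow> b i * 2 ^ N \<in> \<int>"
    "\<And>i. i < n \<Longrightarrow> f (b i) * 2 ^ nat (int N - k i) \<in> \<int>" "\<And>i. i < n \<Longrightarrow> k i \<le> int N"
    by (auto dest!: eventually_happens simp: Ball_def)
  define s where "s j = f (real j / 2 ^ N)" for j
  have piece: "dyadic_interval (s j) (s (Suc j)) \<and>
      (\<forall>x \<in> {real j..real (Suc j)}. f (x / 2 ^ N) = s j + (s (Suc j) - s j) * (x - real j))"
    if j: "j < 2 ^ N" for j
  proof -
    have "real j < 2 ^ N" using j by (metis of_nat_less_iff of_nat_numeral of_nat_power)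
    then obtain i where i: "i < n" "b i \<le> real j / 2 ^ N" "real j / 2 ^ N < b (Suc i)"
      using chain_locate[of b "real j / 2 ^ N" n] b(1,2) by (auto simp: field_simps)
    obtain z where z: "b (Suc i) * 2 ^ N = of_int z" using N(1)[of "Suc i"] i(1) by (auto elim: Ints_cases)
    have "real j < of_int z" using i(3) z by (simp add: field_simps)
    then have "real_of_int (int j) < of_int z" by simp
    then have "int (Suc j) \<le> z" unfolding of_int_less_iff by simp
    then have "real_of_int (int (Suc j)) \<le> of_int z" by (simp only: of_int_le_iff)
    then have "real (Suc j) \<le> of_int z" by simp
    then have Suc_j: "real (Suc j) / 2 ^ N \<le> b (Suc i)" using z by (simp add: field_simps)
    \<comment> \<open>No breakpoint lies inside the \<open>j\<close>-th piece, so \<open>f\<close> is affine on it.\<close>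
    have f_piece: "f (x / 2 ^ N) = s j + 2 powi k i / 2 ^ N * (x - real j)"
      if x: "x \<in> {real j..real (Suc j)}" for x
    proof -
      have "real j / 2 ^ N \<le> x / 2 ^ N" "x / 2 ^ N \<le> real (Suc j) / 2 ^ N"
        using x by (simp_all add: divide_right_mono)
      then have "x / 2 ^ N \<in> {b i..b (Suc i)}" "real j / 2 ^ N \<in> {b i..b (Suc i)}"
        using i(2,3) Suc_j by auto
      from this[THEN lin[OF i(1)]]
      have "f (x / 2 ^ N) - s j = 2 powi k i * (x / 2 ^ N - real j / 2 ^ N)"
        by (simp add: s_def right_diff_distrib)
      also have "\<dots> = 2 powi k i / 2 ^ N * (x - real j)"
        by (simp add: diff_divide_distrib[symmetric])
      finally show ?thesis by simp
    qed
    \<comment> \<open>The image of the \<open>j\<close>-th piece has length \<open>2\<^sup>-\<^sup>D\<close>.\<close>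
    define D where "D = nat (int N - k i)"
    have "2 powi k i * 2 ^ D = (2 powi (k i + int D) :: real)"
      by (simp add: power_int_add)
    also have "k i + int D = int N" using N(3)[OF i(1)] by (simp add: D_def)
    finally have D: "2 powi k i / 2 ^ N = (1 / 2 ^ D :: real)"
      by (simp add: field_simps)
    obtain w where w: "f (b i) * 2 ^ D = of_int w"
      using N(2)[OF i(1)] by (auto simp: D_def elim: Ints_cases)
    obtain v where v: "b i * 2 ^ N = of_int v" using N(1)[of i] i(1) by (auto elim: Ints_cases)
    have "s j = f (b i) + 2 powi k i / 2 ^ N * (real j - b i * 2 ^ N)"
      using lin[OF i(1), of "real j / 2 ^ N"] i(2,3) by (simp add: s_def field_simps)
    then have sj: "s j * 2 ^ D = of_int (w + int j - v)"
      unfolding D using w v by (simp add: field_simps)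
    have "real j / 2 ^ N \<in> {0..1}" using \<open>real j < 2 ^ N\<close> by simp
    then have "0 \<le> s j" using unit unfolding s_def by auto
    then have "0 \<le> w + int j - v" using sj by (metis of_int_0_le_iff zero_le_mult_iff zero_le_numeral zero_le_power)
    then obtain a where a: "w + int j - v = int a" using nonneg_int_cases by blast
    have 1: "s j = real a / 2 ^ D" using sj a by (simp add: field_simps)
    have "s (Suc j) = s j + 1 / 2 ^ D"
      using f_piece[of "real (Suc j)"] unfolding D by (simp add: s_def)
    then have 2: "s (Suc j) = real (Suc a) / 2 ^ D" "s (Suc j) - s j = 1 / 2 ^ D"
      using 1 by (simp_all add: add_divide_distrib)
    show ?thesis
      using 1 2 f_piece unfolding D dyadic_interval_def by auto
  qed
  have "\<exists>u. leaves u = 2 ^ N \<and> (\<forall>i\<le>2 ^ N. tree_fun u i = s i)"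
  proof (rule dyadic_partition_tree)
    show "dyadic_interval (s i) (s (Suc i))" if "i < 2 ^ N" for i
      using piece[OF that] by blast
  qed (simp_all add: s_def f01)
  then obtain u where u: "leaves u = 2 ^ N" "\<And>i. i \<le> 2 ^ N \<Longrightarrow> tree_fun u i = s i" by blast
  have "\<exists>t. leaves t = 2 ^ N \<and> (\<forall>i\<le>2 ^ N. tree_fun t i = real i / 2 ^ N)"
  proof (rule dyadic_partition_tree)
    show "dyadic_interval (real i / 2 ^ N) (real (Suc i) / 2 ^ N)" for i
      unfolding dyadic_interval_def by blast
  qed simp_all
  then obtain t where t: "leaves t = 2 ^ N" "\<And>i. i \<le> 2 ^ N \<Longrightarrow> tree_fun t i = real i / 2 ^ N" by blast
  show thesis
  proof (rule that)
    show "leaves t = leaves u" using t u by simp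
    fix x assume x: "x \<in> {0..real (leaves t)}"
    show "f (tree_fun t x) = tree_fun u x"
    proof (cases "x = real (leaves t)")
      case True
      then show ?thesis using tree_fun_leaves[of t] tree_fun_leaves[of u] t(1) u(1) f01 by simp
    next
      case False
      then obtain j where j: "j < 2 ^ N" "real j \<le> x" "x < real (Suc j)"
        using chain_locate[of real x "2 ^ N"] x t(1) by auto
      have "tree_fun t j = real j / 2 ^ N" "tree_fun t (Suc j) = real (Suc j) / 2 ^ N"
        using t(2) j(1) by (auto simp only: less_imp_le Suc_leI)
      moreover have "tree_fun t x =
          tree_fun t j + (tree_fun t (Suc j) - tree_fun t j) * (x - real j)"
        using t(1) j by (intro tree_fun_interpolate) auto
      ultimately have "tree_fun t x =
          real j / 2 ^ N + (real (Suc j) / 2 ^ N - real j / 2 ^ N) * (x - real j)"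
        by (simp only:)
      then have "tree_fun t x = x / 2 ^ N" by (simp add: field_simps)
      moreover have "tree_fun u x = s j + (s (Suc j) - s j) * (x - real j)"
        using tree_fun_interpolate[of j u x] u(1) u(2)[of j] u(2)[of "Suc j"] j by simp
      ultimately show ?thesis using piece[OF j(1)] j(2,3) by simp
    qed
  qed
qed

section \<open>The automorphism group\<close>

theorem theorem1p1:
  fixes C :: "('o, 'm) moncat" and A :: 'o and \<alpha> :: 'm
  assumes "freely_generated_by_idempotent TYPE('o + nat) TYPE('m + nat) C A \<alpha>"
  shows "aut_group C A \<cong> thompson_F"
proof -
  note free = assms
  interpret M: monoidal_idempotent C A \<alpha>
    using free
    by (auto simp: freely_generated_by_idempotent_def monoidal_idempotent_def
        monoidal_idempotent_axioms_def)
  let ?P = "fraction_cat interval_cat 1 (2, 1, halve)"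
  have "inj_on (Inr :: nat \<Rightarrow> 'o + nat) (Ob ?P)" by (simp add: inj_on_def)
  moreover have "inj_on ((Inr :: nat \<Rightarrow> 'm + nat) \<circ> to_nat_on (Ar ?P)) (Ar ?P)"
    using inj_on_to_nat_on[OF PL.countable_fractions] by (auto simp: PL.fraction_cat_sel inj_on_def)
  ultimately obtain Go Ga where G: "strict_monoidal_functor C ?P Go Ga" "Go A = 1"
    "Ga \<alpha> = (2, 1, halve)"
    using free_functor_exists[OF free PL.fraction_cat_monoidal _ _ PL.fraction_cat_idempotent]
    by blast
  have "strict_monoidal_functor C interval_cat Go Ga"
    using strict_monoidal_functor_comp[OF G(1) PL.fraction_cat_inclusion] by simp
  then interpret G: strict_monoidal_functor C interval_cat Go Ga .
  \<comment> \<open>The functor separates the powers of \<open>A\<close>, so the calculus of fractions applies to \<open>C\<close>.\<close>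
  have "Go (M.mpow n) = n" for n
    using G.functor_obj_power[OF M.M_Ob, of n] G(2) by (simp add: obj_power_interval_cat)
  then have inj: "inj M.mpow" by (metis injI)
  have G_tree: "Ga (M.tree t) = (leaves t, 1, tree_fun t)" for t
    using G.functor_tree_map[OF M.idempotent, of t] G(2,3) by (simp add: tree_map_interval_cat)

  define \<theta> where "\<theta> f = snd (snd (Ga f))" for f
  have G_aut: "Ga f = (1, 1, \<theta> f)" "interval_map 1 1 (\<theta> f)" if "f \<in> hom_set C A A" for f
    using G.Fa_hom[OF that] G(2) by (auto simp: interval_cat_hom \<theta>_def)
  have \<theta>_Cmp: "\<theta> (g \<cdot>\<^bsub>C\<^esub> f) = \<theta> g \<circ> \<theta> f" if "f \<in> hom_set C A A" "g \<in> hom_set C A A" for f g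
  proof -
    have "Ga (g \<cdot>\<^bsub>C\<^esub> f) = (1, 1, \<theta> g \<circ> \<theta> f)"
      using G.Fa_Cmp[OF that] G_aut(1)[OF that(1)] G_aut(1)[OF that(2)]
      by (simp add: interval_cat_sel)
    then show ?thesis by (simp add: \<theta>_def)
  qed
  have \<theta>_Idn: "\<theta> (Idn\<^bsub>C\<^esub> A) = id"
    using G.Fa_Idn[OF M.M_Ob] by (simp add: interval_cat_sel \<theta>_def)
  have tree_pair: "\<exists>t u. leaves t = leaves u \<and> f \<cdot>\<^bsub>C\<^esub> M.tree t = M.tree u \<and>
      \<theta> f \<circ> tree_fun t = tree_fun u" if f: "f \<in> hom_set C A A" for f
  proof -
    obtain ts us where tu: "width ts = width us"
      "f \<in> hom_set C (M.mpow (length ts)) (M.mpow (length us))" "f \<cdot>\<^bsub>C\<^esub> M.forest ts = M.forest us"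
      using free_all_fractions[OF free inj hom_setD(1)[OF f]] by (rule M.fractionsE)
    then have "M.mpow (length ts) = M.mpow 1" "M.mpow (length us) = M.mpow 1"
      using f M.mpow_1 by (auto simp: hom_set_def)
    then have "length ts = 1" "length us = 1" using inj by (auto dest: injD)
    then obtain t u where "ts = [t]" "us = [u]"
      by (auto simp: One_nat_def length_Suc_conv)
    then have 1: "leaves t = leaves u" "f \<cdot>\<^bsub>C\<^esub> M.tree t = M.tree u"
      using tu M.forest_single by simp_all
    have "Ga (f \<cdot>\<^bsub>C\<^esub> M.tree t) = (leaves t, 1, \<theta> f \<circ> tree_fun t)"
      using G.Fa_Cmp[OF M.tree_hom f] G_aut(1)[OF f] G_tree by (simp add: interval_cat_sel)
    then have "\<theta> f \<circ> tree_fun t = tree_fun u" using 1(2) G_tree[of u] by simp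
    then show ?thesis using 1 by blast
  qed

  define \<Theta> where "\<Theta> f = restrict (\<theta> f) {0..1}" for f
  have aut_hom: "f \<in> hom_set C A A" if "f \<in> iso_set C A A" for f
    using that by (simp add: iso_set_def)
  have \<Theta>_F: "\<Theta> f \<in> carrier thompson_F" if f: "f \<in> iso_set C A A" for f
  proof -
    obtain g where g: "f \<in> hom_set C A A" "g \<in> hom_set C A A" "g \<cdot>\<^bsub>C\<^esub> f = Idn\<^bsub>C\<^esub> A"
      "f \<cdot>\<^bsub>C\<^esub> g = Idn\<^bsub>C\<^esub> A"
      using f by (rule M.iso_setE)
    obtain t u where "leaves t = leaves u" "\<theta> f \<circ> tree_fun t = tree_fun u"
      using tree_pair[OF g(1)] by blast
    moreover have "\<theta> f \<circ> \<theta> g = id" "\<theta> g \<circ> \<theta> f = id"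
      using \<theta>_Cmp[of f g] \<theta>_Cmp[of g f] g \<theta>_Idn by simp_all
    ultimately show ?thesis
      unfolding \<Theta>_def using G_aut(2)[OF g(1)] G_aut(2)[OF g(2)] by (intro tree_pair_thompson)
  qed
  have \<Theta>_mult: "\<Theta> (g \<cdot>\<^bsub>C\<^esub> f) = compose {0..1} (\<Theta> g) (\<Theta> f)"
    if "f \<in> hom_set C A A" "g \<in> hom_set C A A" for f g
    using \<theta>_Cmp[OF that] interval_map_unit[OF G_aut(2)[OF that(1)]]
    by (auto simp: \<Theta>_def compose_def fun_eq_iff)
  have \<Theta>_inj: "f = f'" if f: "f \<in> iso_set C A A" and f': "f' \<in> iso_set C A A" and eq: "\<Theta> f = \<Theta> f'"
    for f f'
  proof -
    obtain g where g: "f' \<in> hom_set C A A" "g \<in> hom_set C A A" "g \<cdot>\<^bsub>C\<^esub> f' = Idn\<^bsub>C\<^esub> A"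
      "f' \<cdot>\<^bsub>C\<^esub> g = Idn\<^bsub>C\<^esub> A"
      using f' by (rule M.iso_setE)
    \<comment> \<open>Outside \<open>[0, 1]\<close> all maps \<open>[0, 1) \<rightarrow> [0, 1)\<close> are extended in the same way.\<close>
    have "\<theta> f x = \<theta> f' x" for x
    proof (cases "x \<in> {0..1}")
      case True
      then show ?thesis using fun_cong[OF eq, of x] by (simp add: \<Theta>_def)
    next
      case False
      then show ?thesis
        using interval_mapD(1,4)[OF G_aut(2)[OF aut_hom[OF f]], of x]
          interval_mapD(1,4)[OF G_aut(2)[OF g(1)], of x] by (cases "x < 0") auto
    qed
    then have "\<theta> f = \<theta> f'" by auto
    \<comment> \<open>It remains to show that an automorphism \<open>?h\<close> of \<open>A\<close> acting as the identity is the identity: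
      the two trees of which it is the fraction act in the same way and are thus equal.\<close>
    let ?h = "g \<cdot>\<^bsub>C\<^esub> f"
    have h: "?h \<in> hom_set C A A" using M.Cmp_hom[OF aut_hom[OF f] g(2)] .
    have "\<theta> ?h = id"
      using \<theta>_Cmp[OF aut_hom[OF f] g(2)] \<theta>_Cmp[OF g(1,2)] g(3) \<theta>_Idn \<open>\<theta> f = \<theta> f'\<close> by simp
    moreover obtain t u where tu: "leaves t = leaves u" "?h \<cdot>\<^bsub>C\<^esub> M.tree t = M.tree u"
      "\<theta> ?h \<circ> tree_fun t = tree_fun u"
      using tree_pair[OF h] by blast
    ultimately have "t = u" by (intro tree_fun_eqD) auto
    then have "?h \<cdot>\<^bsub>C\<^esub> M.tree t = Idn\<^bsub>C\<^esub> A \<cdot>\<^bsub>C\<^esub> M.tree t"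
      using tu(2) M.Cmp_Idn_left[OF M.tree_hom] by simp
    then have "?h = Idn\<^bsub>C\<^esub> A"
      using M.iso_cancel_right[OF M.tree_iso h M.Idn_hom[OF M.M_Ob]] by blast
    then have "f' \<cdot>\<^bsub>C\<^esub> ?h = f'" using M.Cmp_Idn_right[OF g(1)] by simp
    then show ?thesis
      using M.Cmp_assoc[OF aut_hom[OF f] g(2,1)] g(4) M.Cmp_Idn_left[OF aut_hom[OF f]] by simp
  qed
  have \<Theta>_surj: "\<exists>\<phi> \<in> iso_set C A A. \<Theta> \<phi> = f" if f: "f \<in> carrier thompson_F" for f
  proof -
    obtain t u where tu: "leaves t = leaves u"
      "\<And>x. x \<in> {0..real (leaves t)} \<Longrightarrow> f (tree_fun t x) = tree_fun u x"
      using thompson_tree_pair[OF f] by blast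
    obtain p where p: "M.tree t \<in> hom_set C (M.mpow (leaves t)) A"
      "p \<in> hom_set C A (M.mpow (leaves t))" "p \<cdot>\<^bsub>C\<^esub> M.tree t = Idn\<^bsub>C\<^esub> (M.mpow (leaves t))"
      "p \<in> iso_set C A (M.mpow (leaves t))"
      using M.tree_iso[of t] by (rule M.iso_setE)
    \<comment> \<open>The fraction of two trees that represent \<open>f\<close>.\<close>
    let ?\<phi> = "M.tree u \<cdot>\<^bsub>C\<^esub> p"
    have u: "M.tree u \<in> iso_set C (M.mpow (leaves t)) A" "M.tree u \<in> hom_set C (M.mpow (leaves t)) A"
      using M.tree_iso[of u] M.tree_hom[of u] tu(1) by simp_all
    have \<phi>: "?\<phi> \<in> iso_set C A A" by (rule M.Cmp_iso[OF p(4) u(1)])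
    have "?\<phi> \<cdot>\<^bsub>C\<^esub> M.tree t = M.tree u"
      using M.Cmp_assoc[OF p(1,2) u(2)] p(3) M.Cmp_Idn_right[OF u(2)] by simp
    then have "\<theta> ?\<phi> \<circ> tree_fun t = tree_fun u"
      using G.Fa_Cmp[OF p(1) aut_hom[OF \<phi>]] G_aut(1)[OF aut_hom[OF \<phi>]] G_tree
      by (simp add: interval_cat_sel)
    then have \<theta>\<phi>: "\<theta> ?\<phi> (tree_fun t x) = tree_fun u x" for x by (metis comp_apply)
    obtain q where q: "interval_map 1 (leaves t) q" "tree_fun t \<circ> q = id"
      by (rule tree_fun_inverse)
    have "\<theta> ?\<phi> y = f y" if y: "y \<in> {0..1}" for y
    proof -
      have "0 \<le> q y" "q y \<le> leaves t"
        using interval_map_nonneg[OF q(1), of y] interval_map_less[OF q(1), of y]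
          interval_mapD(5)[OF q(1)] y by (auto simp: order_le_less)
      moreover have "tree_fun t (q y) = y" using q(2) by (simp add: pointfree_idE)
      ultimately show ?thesis using \<theta>\<phi>[of "q y"] tu(2)[of "q y"] by simp
    qed
    moreover have "f \<in> extensional {0..1}" using f by (simp add: thompson_F_carrier Bij_def)
    ultimately have "\<Theta> ?\<phi> = f"
      unfolding \<Theta>_def by (intro extensionalityI[of _ "{0..1}"]) auto
    then show ?thesis using \<phi> by blast
  qed
  have "\<Theta> \<in> hom (aut_group C A) thompson_F"
    by (rule homI) (auto simp: aut_group_def \<Theta>_F \<Theta>_mult aut_hom thompson_F_mult)
  moreover have "bij_betw \<Theta> (carrier (aut_group C A)) (carrier thompson_F)"
    unfolding bij_betw_def inj_on_def aut_group_def
    using \<Theta>_F \<Theta>_inj by (auto dest!: \<Theta>_surj)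
  ultimately show ?thesis by (auto simp: is_iso_def iso_def)
qed

end
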